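(* Let $h\in\mathbb Z$, $k\in\mathbb Z_{>0}$ with $\gcd(h,k)=1$, let $M,N,a,c$ be positive integers and $b$ an integer with $ac-MNb^2=1$, let $S=\begin{pmatrix} Ma & MNb \\ MNb & Nc \end{pmatrix}$ and $Q(\alpha,\beta)=Ma\alpha^2+2MNb\alpha\beta+Nc\beta^2$. Let $\varepsilon\colon(2S)^{-1}(\mathbb Z^2)\to(2S)^{-1}(\mathbb Z^2)/\mathbb Z^2\to\mathbb C$ be a map such that: (1) $\sum_{\gamma\in(2S)^{-1}(\mathbb Z^2)/\mathbb Z^2}\varepsilon(\gamma)=0$; for every $\gamma=(\alpha,\beta)^\top\in(2S)^{-1}(\mathbb Z^2)$ with $\varepsilon(\gamma)\ne0$, the denominators of $\alpha$ and $\beta$ in lowest terms are $2M$ and $2N$ respectively; and for $\gamma=(\alpha,\beta)^\top\in(2S)^{-1}(\mathbb Z^2)$ with $\varepsilon(\gamma)\neq0$, the classes of $M\alpha$, $N\beta$, $M\alpha^2$, $N\beta^2$, $2MN\alpha\beta$ modulo $\mathbb Z$ are independent of $\gamma$; (2) $\varepsilon(\gamma)=\varepsilon((1,1)^\top-\gamma)=\varepsilon((1-\alpha,\beta)^\top)=\varepsilon((\alpha,1-\beta)^\top)$ for every $\gamma=(\alpha,\beta)^\top\in(2S)^{-1}(\mathbb Z^2)$; (3) there exist maps $\chi\colon\frac1{2M}\mathbb Z\to\frac1{2M}\mathbb Z/\mathbb Z\to\mathbb C$ and $\psi\colon\frac1{2N}\mathbb Z\to\frac1{2N}\mathbb Z/\mathbb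 Z\to\mathbb C$ with $\sum_{\alpha\in\frac1{2M}\mathbb Z/\mathbb Z}\chi(\alpha)=\sum_{\beta\in\frac1{2N}\mathbb Z/\mathbb Z}\psi(\beta)=0$ and $\varepsilon((\alpha,\beta)^\top)=\chi(\alpha)\psi(\beta)$ for all $\alpha,\beta$. Then $$\lim_{t\to+0}F_{Q,\varepsilon}\!\left(\frac hk+t\mathrm i\right)=\frac1{k^2}\sum_{\gamma=(\alpha,\beta)^\top\in(2S)^{-1}(\mathbb Z^2)\cap[0,k)^2}\varepsilon(\gamma)\,\boldsymbol e\!\left(\frac hkQ(\gamma)\right)\alpha\beta .$$
   Context: $\boldsymbol e(z):=e^{2\pi \mathrm i z}$. One has $(2S)^{-1}(\mathbb Z^2)=\frac1{2M}\mathbb Z\oplus\frac1{2N}\mathbb Z$. Maps written as factoring through a quotient by $\mathbb Z^2$ (or $\mathbb Z$) are periodic functions. For $\tau$ in the upper half plane and $q^r:=\boldsymbol e(r\tau)$, the false theta function is $$F_{Q,\varepsilon}(\tau):=\sum_{0\le\gamma\in(2S)^{-1}(\mathbb Z^2)}\varepsilon(\gamma)q^{Q(\gamma)},$$ where $0\le\gamma$ means that both coordinates of $\gamma$ are $\ge0$. *)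

theory Defs
  imports "HOL-Analysis.Analysis"
begin

definition ee :: "complex \<Rightarrow> complex" where
  "ee z = exp (2 * of_real pi * \<i> * z)"

definition int_vecs :: "(real^2) set" where
  "int_vecs = {v. \<forall>i. v $ i \<in> \<int>}"

definition S_mat :: "int \<Rightarrow> int \<Rightarrow> int \<Rightarrow> int \<Rightarrow> int \<Rightarrow> real^2^2" where
  "S_mat M N a b c =
     vector [vector [of_int (M * a), of_int (M * N * b)],
             vector [of_int (M * N * b), of_int (N * c)]]"

definition Q_form :: "int \<Rightarrow> int \<Rightarrow> int \<Rightarrow> int \<Rightarrow> int \<Rightarrow> real^2 \<Rightarrow> real" where
  "Q_form M N a b c \<gamma> =
     of_int (M * a) * (\<gamma> $ 1)\<^sup>2 + 2 * of_int (M * N * b) * \<gamma> $ 1 * \<gamma> $ 2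
       + of_int (N * c) * (\<gamma> $ 2)\<^sup>2"

definition dual_lattice :: "real^2^2 \<Rightarrow> (real^2) set" where
  "dual_lattice S = (\<lambda>v. matrix_inv (2 *\<^sub>R S) *v v) ` int_vecs"

definition frac_multiples :: "int \<Rightarrow> real set" where
  "frac_multiples m = range (\<lambda>r::int. of_int r / of_int m)"

text \<open>For a subgroup \<open>\<Gamma>\<close> of \<open>\<Lambda>\<close>, a map on \<open>\<Lambda>\<close> that factors through
  \<open>\<Lambda> / \<Gamma>\<close> is represented by a function on the ambient type; its values off \<open>\<Lambda>\<close>
  play no role.\<close>

definition factors_through :: "'a::ab_group_add set \<Rightarrow> 'a set \<Rightarrow> ('a \<Rightarrow> 'b) \<Rightarrow> bool" where
  "factors_through \<Lambda> \<Gamma> f \<longleftrightarrow> (\<forall>x\<in>\<Lambda>. \<forall>y\<in>\<Lambda>. x - y \<in> \<Gamma> \<longrightarrow> f x = f y)"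

text \<open>The summand \<open>the_elem (f ` C)\<close> is the common value of \<open>f\<close> on the coset \<open>C\<close>;
  it is meaningful when \<open>f\<close> factors through \<open>\<Lambda> / \<Gamma>\<close>.\<close>

definition quotient_sum ::
    "'a::ab_group_add set \<Rightarrow> 'a set \<Rightarrow> ('a \<Rightarrow> complex) \<Rightarrow> complex" where
  "quotient_sum \<Lambda> \<Gamma> f =
     (\<Sum>C \<in> \<Lambda> // {(x, y). x \<in> \<Lambda> \<and> y \<in> \<Lambda> \<and> x - y \<in> \<Gamma>}. the_elem (f ` C))"

definition lowest_terms_denom :: "real \<Rightarrow> int \<Rightarrow> bool" where
  "lowest_terms_denom x d \<longleftrightarrow> d > 0 \<and> (\<exists>p::int. coprime p d \<and> x = of_int p / of_int d)"

definition false_theta ::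
    "real^2^2 \<Rightarrow> (real^2 \<Rightarrow> real) \<Rightarrow> (real^2 \<Rightarrow> complex) \<Rightarrow> complex \<Rightarrow> complex" where
  "false_theta S Q \<epsilon> \<tau> =
     (\<Sum>\<^sub>\<infinity>\<gamma> \<in> {\<gamma> \<in> dual_lattice S. 0 \<le> \<gamma> $ 1 \<and> 0 \<le> \<gamma> $ 2}. \<epsilon> \<gamma> * ee (of_real (Q \<gamma>) * \<tau>))"

end

theory Submission
  imports Defs
begin

text \<open>Write \<open>\<gamma> = (p/2M, r/2N)\<close> and \<open>G(p, r) = \<epsilon>(\<gamma>) e((h/k) Q(\<gamma>))\<close>, which has periods \<open>P = 2Mk\<close> and
  \<open>R = 2Nk\<close>. Every row sum and every column sum of \<open>G\<close> over a period vanishes. Hence, in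
  \<open>F = \<Sum>G(p, r) f(sp, sr)\<close> with \<open>s = \<surd>t\<close> and a Gaussian \<open>f\<close>, the values of \<open>f\<close> may be replaced, in each
  \<open>P \<times> R\<close> cell, by the mixed second differences of \<open>f\<close> from the corner of the cell. Up to \<open>O(s)\<close> in total,
  the difference with steps \<open>(p, r)\<close> is \<open>pr/PR\<close> times the one over the full cell, and the latter
  telescope to \<open>f(0, 0) = 1\<close>. So the limit is \<open>\<Sum>G(p, r) pr/PR\<close>.\<close>

subsection \<open>Mixed second differences of a Gaussian\<close>

text \<open>The vanishing of the row and column sums is the arithmetic core. As the weight is
  chi(\<alpha>) psi(\<beta>), a row sum is, up to a factor depending on \<alpha>, a sum of psi
  against a quadratic exponential in one variable. Grouping the terms by r mod 2N gives a sum of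
  Y(r) I(r), where I(r) has k terms. Since Y sums to zero, it suffices that I is constant on the
  support of Y. The lowest-terms condition and the constancy of N \<beta>^2 mod 1 yield this when N
  and k are coprime; otherwise I vanishes on that support.

  The analytic obstacle is that the Gaussian sum over a single residue class diverges like 1/s^2.
  Mixed second differences are of size s^2 on about 1/s^2 relevant cells, and comparing one with its
  proportional share of the full cell costs only s^3, hence O(s) in total. Bounds by exp(-x) exp(-y)
  make this count precise, because on a grid they sum to a product of two geometric series. Of the
  quadratic form only positive definiteness is needed there, so the mixed term B requires no
  separate treatment.\<close>

definition gauss :: "real \<Rightarrow> real \<Rightarrow> real \<Rightarrow> real \<Rightarrow> real \<Rightarrow> real" where
  "gauss A B C x y = exp (- (A * x\<^sup>2 + 2 * B * x * y + C * y\<^sup>2))"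

definition gauss_xy :: "real \<Rightarrow> real \<Rightarrow> real \<Rightarrow> real \<Rightarrow> real \<Rightarrow> real" where
  "gauss_xy A B C x y = ((2*A*x + 2*B*y) * (2*B*x + 2*C*y) - 2*B) * gauss A B C x y"

text \<open>The prefactor is a cubic polynomial in x and y, which is the origin of the cubed weights
  in the decay bounds.\<close>

definition gauss_xxy :: "real \<Rightarrow> real \<Rightarrow> real \<Rightarrow> real \<Rightarrow> real \<Rightarrow> real" where
  "gauss_xxy A B C x y = (2*A * (2*B*x + 2*C*y) + (2*A*x + 2*B*y) * (2*B)
     - ((2*A*x + 2*B*y) * (2*B*x + 2*C*y) - 2*B) * (2*A*x + 2*B*y)) * gauss A B C x y"

lemma gauss_swap: "gauss A B C x y = gauss C B A y x"
  by (simp add: gauss_def algebra_simps)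

text \<open>The symmetry turns a bound on the xxy derivative for (C, B, A) into one on the xyy
  derivative for (A, B, C), so a single third-order estimate suffices.\<close>

lemma gauss_xy_swap: "gauss_xy A B C x y = gauss_xy C B A y x"
  unfolding gauss_xy_def gauss_swap[of A B C x y] by (simp only: mult.commute add.commute)

lemma gauss_pos: "gauss A B C x y > 0"
  by (simp add: gauss_def)

lemma DERIV_gauss_x:
  "((\<lambda>x. gauss A B C x y) has_real_derivative - (2*A*x + 2*B*y) * gauss A B C x y) (at x)"
  unfolding gauss_def by (auto intro!: derivative_eq_intros simp: algebra_simps)

lemma DERIV_gauss_y:
  "((\<lambda>y. gauss A B C x y) has_real_derivative - (2*B*x + 2*C*y) * gauss A B C x y) (at y)"
  unfolding gauss_def by (auto intro!: derivative_eq_intros simp: algebra_simps)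

lemma DERIV_gauss_xy:
  "((\<lambda>y. - (2*A*x + 2*B*y) * gauss A B C x y) has_real_derivative gauss_xy A B C x y) (at y)"
proof -
  have "((\<lambda>y. - (2*A*x + 2*B*y)) has_real_derivative - (2*B)) (at y)"
    by (auto intro!: derivative_eq_intros)
  from DERIV_mult[OF this DERIV_gauss_y[of A B C x y]] show ?thesis
    by (rule DERIV_cong) (simp add: gauss_xy_def algebra_simps)
qed

lemma DERIV_gauss_xxy:
  "((\<lambda>x. gauss_xy A B C x y) has_real_derivative gauss_xxy A B C x y) (at x)"
proof -
  have "((\<lambda>x. (2*A*x + 2*B*y) * (2*B*x + 2*C*y) - 2*B) has_real_derivative
      2*A * (2*B*x + 2*C*y) + (2*A*x + 2*B*y) * (2*B)) (at x)"
    by (auto intro!: derivative_eq_intros)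
  from DERIV_mult[OF this DERIV_gauss_x[of A B C y x]] show ?thesis
    unfolding gauss_xy_def by (rule DERIV_cong) (simp add: gauss_xxy_def algebra_simps)
qed

section \<open>Coercivity of the form and exponential decay on the first quadrant\<close>

lemma posdef_coercive:
  fixes A B C :: real
  assumes "A > 0" "B\<^sup>2 < A * C"
  obtains d where "d > 0" "\<And>x y. A * x\<^sup>2 + 2 * B * x * y + C * y\<^sup>2 \<ge> d * (x\<^sup>2 + y\<^sup>2)"
proof -
  have "0 < A * C" using assms zero_le_power2[of B] by linarith
  then have C: "C > 0" using assms by (simp add: zero_less_mult_iff)
  \<comment> \<open>Determinant over trace, a positive lower bound for the smaller eigenvalue.
    Subtracting d from both diagonal entries leaves determinant d^2, so completing the square below
    shows that the reduced form is still nonnegative.\<close>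
  define d where "d = (A * C - B\<^sup>2) / (A + C)"
  have d: "d > 0" using assms C by (simp add: d_def)
  have dAC: "d * (A + C) = A * C - B\<^sup>2" using assms C by (simp add: d_def)
  have "(A - d) * (A + C) = A\<^sup>2 + B\<^sup>2"
    using dAC by (simp add: algebra_simps power2_eq_square)
  then have "(A - d) * (A + C) > 0"
    using assms by (simp add: add_pos_nonneg)
  then have Ad: "A - d > 0"
    using assms C by (simp add: zero_less_mult_iff)
  show ?thesis
  proof (rule that[OF d])
    fix x y
    have "(A - d) * ((A - d) * x\<^sup>2 + 2 * B * x * y + (C - d) * y\<^sup>2)
        = ((A - d) * x + B * y)\<^sup>2 + ((A * C - B\<^sup>2 - d * (A + C)) + d\<^sup>2) * y\<^sup>2"
      by (simp add: algebra_simps power2_eq_square)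
    also have "\<dots> \<ge> 0" using dAC by simp
    finally have "(A - d) * x\<^sup>2 + 2 * B * x * y + (C - d) * y\<^sup>2 \<ge> 0"
      using Ad by (simp add: zero_le_mult_iff)
    then show "A * x\<^sup>2 + 2 * B * x * y + C * y\<^sup>2 \<ge> d * (x\<^sup>2 + y\<^sup>2)"
      by (simp add: algebra_simps)
  qed
qed

text \<open>The cubic is absorbed into exp(3x), and 4x - d x^2 is at most 4/d because (d x - 2)^2 is
  nonnegative; one unit of x is kept as decay.\<close>

lemma poly_exp_bound:
  fixes d x :: real
  assumes "d > 0" "x \<ge> 0"
  shows "(1 + x)^3 * exp (- (d * x\<^sup>2)) \<le> exp (4/d) * exp (- x)"
proof -
  have "(1 + x)^3 \<le> exp x ^ 3"
    using assms by (intro power_mono) (auto simp: exp_ge_add_one_self)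
  also have "\<dots> = exp (3 * x)"
    by (metis exp_of_nat_mult of_nat_numeral)
  finally have "(1 + x)^3 * exp (- (d * x\<^sup>2)) \<le> exp (3 * x) * exp (- (d * x\<^sup>2))"
    by simp
  also have "\<dots> = exp (3 * x - d * x\<^sup>2)" by (simp add: exp_add[symmetric])
  also have "\<dots> \<le> exp (4/d - x)"
  proof -
    have "0 \<le> (d * x - 2)\<^sup>2" by simp
    then have "d * (4 * x) \<le> d * (4/d + d * x\<^sup>2)"
      using assms by (simp add: power2_eq_square algebra_simps)
    then have "4 * x \<le> 4/d + d * x\<^sup>2" using assms by simp
    then show ?thesis by simp
  qed
  also have "\<dots> = exp (4/d) * exp (- x)" by (simp add: exp_add[symmetric])
  finally show ?thesis .
qed

text \<open>Coercivity splits the Gaussian into two one-variable factors, and the weight is a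
  product as well. The cubed weight controls every prefactor arising in a third derivative.\<close>

lemma gauss_decay:
  fixes A B C :: real
  assumes "A > 0" "B\<^sup>2 < A * C"
  obtains K where "K > 0"
    "\<And>x y. x \<ge> 0 \<Longrightarrow> y \<ge> 0 \<Longrightarrow> ((1 + x) * (1 + y))^3 * gauss A B C x y \<le> K * (exp (- x) * exp (- y))"
proof -
  obtain d where d: "d > 0" "\<And>x y. A * x\<^sup>2 + 2 * B * x * y + C * y\<^sup>2 \<ge> d * (x\<^sup>2 + y\<^sup>2)"
    using posdef_coercive[OF assms] by blast
  show ?thesis
  proof (rule that[of "exp (4/d) * exp (4/d)"])
    fix x y :: real assume xy: "x \<ge> 0" "y \<ge> 0"
    have "((1 + x) * (1 + y))^3 * gauss A B C x y
        \<le> ((1 + x) * (1 + y))^3 * exp (- (d * (x\<^sup>2 + y\<^sup>2)))"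
      using d(2)[of x y] xy by (intro mult_left_mono) (auto simp: gauss_def)
    also have "exp (- (d * (x\<^sup>2 + y\<^sup>2))) = exp (- (d * x\<^sup>2)) * exp (- (d * y\<^sup>2))"
      by (simp add: distrib_left flip: exp_add)
    also have "((1 + x) * (1 + y))^3 * \<dots>
        = ((1 + x)^3 * exp (- (d * x\<^sup>2))) * ((1 + y)^3 * exp (- (d * y\<^sup>2)))"
      by (simp only: power_mult_distrib mult.assoc mult.left_commute)
    also have "\<dots> \<le> (exp (4/d) * exp (- x)) * (exp (4/d) * exp (- y))"
      using d(1) xy by (intro mult_mono poly_exp_bound) auto
    finally show "((1 + x) * (1 + y))^3 * gauss A B C x y
        \<le> exp (4/d) * exp (4/d) * (exp (- x) * exp (- y))" by (simp add: algebra_simps)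
  qed simp
qed

text \<open>With w = (1 + x)(1 + y), which dominates 1, x and y, both linear forms in the prefactor
  are at most c w. Three of its terms then contribute c^2 w and one contributes c^3 w^3, whence the
  constant.\<close>

lemma gauss_xxy_decay:
  fixes A B C :: real
  assumes "A > 0" "B\<^sup>2 < A * C"
  obtains K where "K > 0"
    "\<And>x y. x \<ge> 0 \<Longrightarrow> y \<ge> 0 \<Longrightarrow> \<bar>gauss_xxy A B C x y\<bar> \<le> K * (exp (- x) * exp (- y))"
proof -
  obtain K where K: "K > 0" "\<And>x y. x \<ge> 0 \<Longrightarrow> y \<ge> 0 \<Longrightarrow>
      ((1 + x) * (1 + y))^3 * gauss A B C x y \<le> K * (exp (- x) * exp (- y))"
    using gauss_decay[OF assms] by blast
  define c where "c = 2 * (\<bar>A\<bar> + \<bar>B\<bar> + \<bar>C\<bar>)"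
  have c: "c > 0" using assms by (simp add: c_def)
  show ?thesis
  proof (rule that[of "(3 * c^2 + c^3) * K"])
    show "(3 * c^2 + c^3) * K > 0" using c K(1) by (simp add: add_pos_pos)
    fix x y :: real assume xy: "x \<ge> 0" "y \<ge> 0"
    define w where "w = (1 + x) * (1 + y)"
    have w: "1 \<le> w" "x \<le> w" "y \<le> w" using xy by (auto simp: w_def algebra_simps)
    have lin: "\<bar>2*a*x + 2*b*y\<bar> \<le> c * w" if "\<bar>a\<bar> + \<bar>b\<bar> \<le> c/2" for a b
    proof -
      have "\<bar>2*a*x + 2*b*y\<bar> \<le> 2 * (\<bar>a\<bar> * x) + 2 * (\<bar>b\<bar> * y)"
        using xy abs_triangle_ineq[of "2*a*x" "2*b*y"] by (simp add: abs_mult)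
      also have "\<dots> \<le> 2 * (\<bar>a\<bar> * w) + 2 * (\<bar>b\<bar> * w)"
        using w by (intro add_mono mult_left_mono) auto
      also have "\<dots> = 2 * (\<bar>a\<bar> + \<bar>b\<bar>) * w" by (simp add: algebra_simps)
      also have "\<dots> \<le> c * w" using that w by (intro mult_right_mono) auto
      finally show ?thesis .
    qed
    define l1 where "l1 = 2*A*x + 2*B*y"
    define l2 where "l2 = 2*B*x + 2*C*y"
    have l: "\<bar>l1\<bar> \<le> c * w" "\<bar>l2\<bar> \<le> c * w"
      unfolding l1_def l2_def by (rule lin, simp add: c_def)+
    have ab: "\<bar>2*A\<bar> \<le> c" "\<bar>2*B\<bar> \<le> c" by (auto simp: c_def)
    have "\<bar>2*A * l2 + l1 * (2*B) - (l1 * l2 - 2*B) * l1\<bar>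
        \<le> \<bar>2*A\<bar> * \<bar>l2\<bar> + \<bar>l1\<bar> * \<bar>2*B\<bar> + (\<bar>l1\<bar> * \<bar>l2\<bar> * \<bar>l1\<bar> + \<bar>2*B\<bar> * \<bar>l1\<bar>)"
    proof -
      have "2*A * l2 + l1 * (2*B) - (l1 * l2 - 2*B) * l1
        = 2*A * l2 + l1 * (2*B) - l1 * l2 * l1 + 2*B * l1" by (simp add: algebra_simps)
      then show ?thesis unfolding abs_mult[symmetric] by linarith
    qed
    also have "\<dots> \<le> c * (c * w) + (c * w) * c + ((c*w)*(c*w)*(c*w) + c * (c * w))"
    proof -
      have pos: "0 \<le> c" "0 \<le> c * w" using c w by auto
      have "\<bar>2*A\<bar> * \<bar>l2\<bar> \<le> c * (c * w)" "\<bar>l1\<bar> * \<bar>2*B\<bar> \<le> (c * w) * c"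
        "\<bar>2*B\<bar> * \<bar>l1\<bar> \<le> c * (c * w)" "\<bar>l1\<bar> * \<bar>l2\<bar> \<le> (c*w) * (c*w)"
        using l ab pos by (simp_all only: mult_mono abs_ge_zero)
      moreover from this(4) have "\<bar>l1\<bar> * \<bar>l2\<bar> * \<bar>l1\<bar> \<le> (c*w)*(c*w)*(c*w)"
        by (rule mult_mono[OF _ l(1)]) (use pos in \<open>simp_all only: mult_nonneg_nonneg abs_ge_zero\<close>)
      ultimately show ?thesis by (simp only: add_mono)
    qed
    also have "\<dots> = 3 * c^2 * w + c^3 * w^3"
      by (simp add: algebra_simps power2_eq_square power3_eq_cube)
    also have "\<dots> \<le> 3 * c^2 * w^3 + c^3 * w^3"
      using w c self_le_power[of w 3] by (intro add_mono mult_left_mono) auto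
    also have "\<dots> = (3 * c^2 + c^3) * w^3" by (simp add: algebra_simps)
    finally have "\<bar>2*A * l2 + l1 * (2*B) - (l1 * l2 - 2*B) * l1\<bar> \<le> (3 * c^2 + c^3) * w^3" .
    then have "\<bar>2*A * l2 + l1 * (2*B) - (l1 * l2 - 2*B) * l1\<bar> * gauss A B C x y
       \<le> (3 * c^2 + c^3) * w^3 * gauss A B C x y"
      using gauss_pos[of A B C x y] by (intro mult_right_mono) auto
    then have "\<bar>gauss_xxy A B C x y\<bar> \<le> (3 * c^2 + c^3) * (w^3 * gauss A B C x y)"
      using gauss_pos[of A B C x y]
      by (simp add: gauss_xxy_def abs_mult l1_def l2_def mult.assoc)
    also have "\<dots> \<le> (3 * c^2 + c^3) * (K * (exp (- x) * exp (- y)))"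
      using K(2)[OF xy] c by (intro mult_left_mono) (auto simp: w_def)
    finally show "\<bar>gauss_xxy A B C x y\<bar> \<le> (3 * c^2 + c^3) * K * (exp (- x) * exp (- y))"
      by (simp add: mult.assoc)
  qed
qed

text \<open>Mean value theorem; since exp(-x) decreases, the bound at the intermediate point may be
  moved to the left end x.\<close>

lemma gauss_xy_increment_x:
  assumes K: "K > 0"
    "\<And>x y. x \<ge> 0 \<Longrightarrow> y \<ge> 0 \<Longrightarrow> \<bar>gauss_xxy A B C x y\<bar> \<le> K * (exp (- x) * exp (- y))"
    and "0 \<le> x" "x \<le> u" "0 \<le> y"
  shows "\<bar>gauss_xy A B C u y - gauss_xy A B C x y\<bar> \<le> K * (u - x) * (exp (- x) * exp (- y))"
proof (cases "x = u")
  case False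
  with assms(4) have "x < u" by simp
  from MVT2[OF this DERIV_gauss_xxy] obtain z where z: "x < z" "z < u"
    "gauss_xy A B C u y - gauss_xy A B C x y = (u - x) * gauss_xxy A B C z y" by blast
  have "\<bar>gauss_xxy A B C z y\<bar> \<le> K * (exp (- z) * exp (- y))"
    using z assms(3-5) by (intro K(2)) auto
  also have "\<dots> \<le> K * (exp (- x) * exp (- y))"
    using z K(1) by (intro mult_left_mono mult_right_mono) auto
  finally have "(u - x) * \<bar>gauss_xxy A B C z y\<bar> \<le> (u - x) * (K * (exp (- x) * exp (- y)))"
    using assms(3-5) by (intro mult_left_mono) auto
  then have "\<bar>(u - x) * gauss_xxy A B C z y\<bar> \<le> K * (u - x) * (exp (- x) * exp (- y))"
    using assms(3-5) by (simp only: abs_mult mult.left_commute mult.assoc abs_of_nonneg diff_ge_0_iff_ge)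
  then show ?thesis by (simp only: z)
qed simp

text \<open>The path goes along x at height v, then along y at abscissa x; the second leg is the
  first one after exchanging the variables.\<close>

lemma gauss_xy_increment:
  fixes A B C :: real
  assumes "A > 0" "B\<^sup>2 < A * C"
  obtains K where "K > 0"
    "\<And>x y u v. 0 \<le> x \<Longrightarrow> x \<le> u \<Longrightarrow> 0 \<le> y \<Longrightarrow> y \<le> v \<Longrightarrow>
       \<bar>gauss_xy A B C u v - gauss_xy A B C x y\<bar> \<le> K * ((u - x) + (v - y)) * (exp (- x) * exp (- y))"
proof -
  have "0 < A * C" using assms zero_le_power2[of B] by linarith
  then have C: "C > 0" "B\<^sup>2 < C * A"
    using assms by (simp_all add: zero_less_mult_iff mult.commute)
  obtain K1 where K1: "K1 > 0"
    "\<And>x y. x \<ge> 0 \<Longrightarrow> y \<ge> 0 \<Longrightarrow> \<bar>gauss_xxy A B C x y\<bar> \<le> K1 * (exp (- x) * exp (- y))"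
    using gauss_xxy_decay[OF assms] by blast
  obtain K2 where K2: "K2 > 0"
    "\<And>x y. x \<ge> 0 \<Longrightarrow> y \<ge> 0 \<Longrightarrow> \<bar>gauss_xxy C B A x y\<bar> \<le> K2 * (exp (- x) * exp (- y))"
    using gauss_xxy_decay[OF C] by blast
  show ?thesis
  proof (rule that[of "K1 + K2"])
    fix x y u v :: real assume *: "0 \<le> x" "x \<le> u" "0 \<le> y" "y \<le> v"
    have "\<bar>gauss_xy A B C u v - gauss_xy A B C x v\<bar> \<le> K1 * (u - x) * (exp (- x) * exp (- v))"
      using * by (intro gauss_xy_increment_x K1(1) K1(2)) auto
    also have "\<dots> \<le> (K1 + K2) * (u - x) * (exp (- x) * exp (- y))"
      using * K1(1) K2(1) by (intro mult_mono) auto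
    finally have 1: "\<bar>gauss_xy A B C u v - gauss_xy A B C x v\<bar>
      \<le> (K1 + K2) * (u - x) * (exp (- x) * exp (- y))" .
    have "\<bar>gauss_xy C B A v x - gauss_xy C B A y x\<bar> \<le> K2 * (v - y) * (exp (- y) * exp (- x))"
      using * by (intro gauss_xy_increment_x K2(1) K2(2)) auto
    also have "\<dots> \<le> (K1 + K2) * (v - y) * (exp (- y) * exp (- x))"
      using * K1(1) K2(1) by (intro mult_mono) auto
    finally have 2: "\<bar>gauss_xy A B C x v - gauss_xy A B C x y\<bar>
      \<le> (K1 + K2) * (v - y) * (exp (- x) * exp (- y))"
      by (simp add: gauss_xy_swap[of A] mult.commute)
    from 1 2 show "\<bar>gauss_xy A B C u v - gauss_xy A B C x y\<bar>
      \<le> (K1 + K2) * ((u - x) + (v - y)) * (exp (- x) * exp (- y))"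
      by (simp add: algebra_simps)
  qed (use K1(1) K2(1) in simp)
qed

section \<open>Mean values of mixed second differences\<close>

definition diff2 :: "(real \<Rightarrow> real \<Rightarrow> real) \<Rightarrow> real \<Rightarrow> real \<Rightarrow> real \<Rightarrow> real \<Rightarrow> real" where
  "diff2 f x y u v = f (x + u) (y + v) - f x (y + v) - f (x + u) y + f x y"

text \<open>The mean value theorem is applied in x to the difference in y, then in y to the
  resulting x derivative. Zero steps are separated because it needs a proper interval.\<close>

lemma diff2_gauss:
  assumes "u \<ge> 0" "v \<ge> 0"
  obtains z w where "x \<le> z" "z \<le> x + u" "y \<le> w" "w \<le> y + v"
    "diff2 (gauss A B C) x y u v = u * v * gauss_xy A B C z w"
proof (cases "u = 0 \<or> v = 0")
  case True
  then show ?thesis using assms by (intro that[of x y]) (auto simp: diff2_def)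
next
  case False
  then have uv: "u > 0" "v > 0" using assms by auto
  have D: "((\<lambda>x. gauss A B C x (y + v) - gauss A B C x y) has_real_derivative
     (- (2*A*x + 2*B*(y+v)) * gauss A B C x (y+v)) - (- (2*A*x + 2*B*y) * gauss A B C x y)) (at x)" for x
    by (intro DERIV_diff DERIV_gauss_x)
  have "x < x + u" using uv by simp
  from MVT2[OF this D, unfolded add_diff_cancel_left'] obtain z where z: "x < z" "z < x + u" and
    "(gauss A B C (x+u) (y + v) - gauss A B C (x+u) y) - (gauss A B C x (y + v) - gauss A B C x y)
     = u * ((- (2*A*z + 2*B*(y+v)) * gauss A B C z (y+v)) - (- (2*A*z + 2*B*y) * gauss A B C z y))"
    by blast
  moreover have "y < y + v" using uv by simp
  from MVT2[OF this DERIV_gauss_xy[of A z B C], unfolded add_diff_cancel_left'] obtain w where w: "y < w" "w < y + v" and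
    "(- (2*A*z + 2*B*(y+v)) * gauss A B C z (y+v)) - (- (2*A*z + 2*B*y) * gauss A B C z y)
     = v * gauss_xy A B C z w" by blast
  ultimately have "diff2 (gauss A B C) x y u v = u * v * gauss_xy A B C z w"
    by (simp add: diff2_def)
  then show ?thesis using z w by (intro that[of z w]) auto
qed

text \<open>Each difference, divided by its area, is a value of the mixed derivative somewhere in
  the same U by V cell. Both values are within K (U + V) exp(-x) exp(-y) of the one at the corner,
  which accounts for the factor 2.\<close>

lemma diff2_gauss_proportional:
  fixes A B C :: real
  assumes "A > 0" "B\<^sup>2 < A * C"
  obtains K where "K > 0"
    "\<And>x y u v U V. 0 \<le> x \<Longrightarrow> 0 \<le> y \<Longrightarrow> 0 \<le> u \<Longrightarrow> u \<le> U \<Longrightarrow> 0 \<le> v \<Longrightarrow> v \<le> V \<Longrightarrow> 0 < U \<Longrightarrow> 0 < V \<Longrightarrow>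
       \<bar>diff2 (gauss A B C) x y u v - u * v / (U * V) * diff2 (gauss A B C) x y U V\<bar>
         \<le> K * (U * V * (U + V)) * (exp (- x) * exp (- y))"
proof -
  obtain K where K: "K > 0" "\<And>x y u v. 0 \<le> x \<Longrightarrow> x \<le> u \<Longrightarrow> 0 \<le> y \<Longrightarrow> y \<le> v \<Longrightarrow>
       \<bar>gauss_xy A B C u v - gauss_xy A B C x y\<bar> \<le> K * ((u - x) + (v - y)) * (exp (- x) * exp (- y))"
    using gauss_xy_increment[OF assms] by blast
  show ?thesis
  proof (rule that[of "2 * K"])
    fix x y u v U V :: real
    assume *: "0 \<le> x" "0 \<le> y" "0 \<le> u" "u \<le> U" "0 \<le> v" "v \<le> V" "0 < U" "0 < V"
    let ?E = "exp (- x) * exp (- y)"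
    obtain z w where zw: "x \<le> z" "z \<le> x + u" "y \<le> w" "w \<le> y + v"
      "diff2 (gauss A B C) x y u v = u * v * gauss_xy A B C z w"
      using diff2_gauss[OF *(3) *(5)] by blast
    have UV: "0 \<le> U" "0 \<le> V" using * by auto
    obtain z' w' where zw': "x \<le> z'" "z' \<le> x + U" "y \<le> w'" "w' \<le> y + V"
      "diff2 (gauss A B C) x y U V = U * V * gauss_xy A B C z' w'"
      using diff2_gauss[OF UV] by blast
    have near: "\<bar>gauss_xy A B C z w - gauss_xy A B C x y\<bar> \<le> K * (U + V) * ?E"
      if "x \<le> z" "z \<le> x + U" "y \<le> w" "w \<le> y + V" for z w
    proof -
      have "\<bar>gauss_xy A B C z w - gauss_xy A B C x y\<bar> \<le> K * ((z - x) + (w - y)) * ?E"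
        using * that by (intro K(2)) auto
      also have "\<dots> \<le> K * (U + V) * ?E"
        using that K(1) by (intro mult_right_mono mult_left_mono) auto
      finally show ?thesis .
    qed
    have "\<bar>gauss_xy A B C z w - gauss_xy A B C z' w'\<bar> \<le> 2 * (K * (U + V) * ?E)"
      using near[of z w] near[of z' w'] zw zw' * by linarith
    then have le: "u * v * \<bar>gauss_xy A B C z w - gauss_xy A B C z' w'\<bar>
       \<le> U * V * (2 * (K * (U + V) * ?E))"
      using * by (intro mult_mono) auto
    have "diff2 (gauss A B C) x y u v - u * v / (U * V) * diff2 (gauss A B C) x y U V
      = u * v * (gauss_xy A B C z w - gauss_xy A B C z' w')"
      unfolding zw(5) zw'(5) using *(7,8) by (simp add: right_diff_distrib)
    then have "\<bar>diff2 (gauss A B C) x y u v - u * v / (U * V) * diff2 (gauss A B C) x y U V\<bar>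
      = u * v * \<bar>gauss_xy A B C z w - gauss_xy A B C z' w'\<bar>"
      using *(3,5) by (simp add: abs_mult)
    also note le
    also have "U * V * (2 * (K * (U + V) * ?E)) = 2 * K * (U * V * (U + V)) * ?E"
      by (simp only: mult.assoc mult.left_commute mult.commute)
    finally show "\<bar>diff2 (gauss A B C) x y u v - u * v / (U * V) * diff2 (gauss A B C) x y U V\<bar>
         \<le> 2 * K * (U * V * (U + V)) * ?E" .
  qed (use K(1) in simp)
qed

subsection \<open>Sums over the lattice\<close>

lemma has_sum_minus:
  fixes f g :: "'a \<Rightarrow> 'b :: real_normed_vector"
  assumes "(f has_sum a) A" "(g has_sum b) A"
  shows "((\<lambda>x. f x - g x) has_sum (a - b)) A"
  using has_sum_add[OF assms(1), of "\<lambda>x. - g x" "- b"] assms(2) by (simp add: has_sum_uminus)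

lemma summable_on_minus:
  fixes f g :: "'a \<Rightarrow> 'b :: real_normed_vector"
  assumes "f summable_on A" "g summable_on A"
  shows "(\<lambda>x. f x - g x) summable_on A"
  using assms has_sum_minus unfolding summable_on_def by blast

text \<open>A summable sequence tends to 0, so no boundary term survives at infinity.\<close>

lemma telescope_infsum_nat:
  fixes f :: "nat \<Rightarrow> real"
  assumes "f summable_on UNIV"
  shows "(\<Sum>\<^sub>\<infinity>n. f n - f (Suc n)) = f 0"
proof -
  have "f sums infsum f UNIV"
    using assms has_sum_infsum has_sum_imp_sums by blast
  then have "f \<longlonglongrightarrow> 0" by (rule summable_LIMSEQ_zero[OF sums_summable])
  then have "(\<lambda>n. f n - f (Suc n)) sums (f 0 - 0)" by (rule telescope_sums')
  moreover have "(\<lambda>n. f n - f (Suc n)) summable_on UNIV"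
  proof -
    have "f summable_on range Suc" using assms by (rule summable_on_subset_banach) simp
    then have "(\<lambda>n. f (Suc n)) summable_on UNIV"
      by (subst (asm) summable_on_reindex) (auto simp: o_def)
    then show ?thesis using assms by (intro summable_on_minus)
  qed
  then have "(\<lambda>n. f n - f (Suc n)) sums (\<Sum>\<^sub>\<infinity>n. f n - f (Suc n))"
    using has_sum_infsum has_sum_imp_sums by blast
  ultimately show ?thesis using sums_unique2 by fastforce
qed

text \<open>For fixed m the sequence \<open>f m n - f (Suc m) n\<close> telescopes in n to its value
  at n = 0, and the remaining sum over m telescopes to the corner. Summability on the whole grid
  permits the iterated summation.\<close>

lemma telescope_infsum_nat2:
  fixes f :: "nat \<Rightarrow> nat \<Rightarrow> real"
  assumes f: "(\<lambda>(m,n). f m n) summable_on UNIV"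
  shows "(\<Sum>\<^sub>\<infinity>(m,n). f (Suc m) (Suc n) - f m (Suc n) - f (Suc m) n + f m n) = f 0 0"
proof -
  have shift: "(\<lambda>(m,n). f (\<sigma> m) (\<tau> n)) summable_on UNIV" if "inj \<sigma>" "inj \<tau>" for \<sigma> \<tau>
  proof -
    have "(\<lambda>(m,n). f m n) summable_on range (map_prod \<sigma> \<tau>)"
      using f by (rule summable_on_subset_banach) simp
    moreover have "inj (map_prod \<sigma> \<tau>)" using that by (rule prod.inj_map)
    ultimately show ?thesis
      by (subst (asm) summable_on_reindex) (auto simp: o_def case_prod_unfold)
  qed
  have s: "(\<lambda>(m,n). f (Suc m) (Suc n)) summable_on UNIV" "(\<lambda>(m,n). f m (Suc n)) summable_on UNIV"
    "(\<lambda>(m,n). f (Suc m) n) summable_on UNIV"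
    using shift[of Suc Suc] shift[of "\<lambda>x. x" Suc] shift[of Suc "\<lambda>x. x"] by (simp_all add: inj_on_def)
  have sD: "(\<lambda>(m,n). f (Suc m) (Suc n) - f m (Suc n) - f (Suc m) n + f m n) summable_on UNIV"
    using summable_on_add[OF summable_on_minus[OF summable_on_minus[OF s(1,2)] s(3)] f]
    by (simp add: case_prod_unfold)
  have row: "(\<lambda>n. f m n) summable_on UNIV" for m
  proof -
    have "(\<lambda>(m,n). f m n) summable_on range (Pair m)"
      using f by (rule summable_on_subset_banach) simp
    then show ?thesis
      by (subst (asm) summable_on_reindex) (auto simp: inj_on_def o_def)
  qed
  have col: "(\<lambda>m. f m 0) summable_on UNIV"
  proof -
    have "(\<lambda>(m,n). f m n) summable_on range (\<lambda>m. (m, 0))"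
      using f by (rule summable_on_subset_banach) simp
    then show ?thesis
      by (subst (asm) summable_on_reindex) (auto simp: inj_on_def o_def)
  qed
  have "(\<Sum>\<^sub>\<infinity>(m,n). f (Suc m) (Suc n) - f m (Suc n) - f (Suc m) n + f m n)
    = (\<Sum>\<^sub>\<infinity>m. \<Sum>\<^sub>\<infinity>n. f (Suc m) (Suc n) - f m (Suc n) - f (Suc m) n + f m n)"
    using infsum_Sigma'_banach[of "\<lambda>m n. f (Suc m) (Suc n) - f m (Suc n) - f (Suc m) n + f m n" UNIV "\<lambda>_. UNIV"] sD
    by simp
  also have "\<dots> = (\<Sum>\<^sub>\<infinity>m. f m 0 - f (Suc m) 0)"
  proof (rule infsum_cong)
    fix m
    have "(\<Sum>\<^sub>\<infinity>n. (f m n - f (Suc m) n) - (f m (Suc n) - f (Suc m) (Suc n))) = f m 0 - f (Suc m) 0"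
      by (rule telescope_infsum_nat[where f = "\<lambda>n. f m n - f (Suc m) n"]) (intro summable_on_minus row)
    then show "(\<Sum>\<^sub>\<infinity>n. f (Suc m) (Suc n) - f m (Suc n) - f (Suc m) n + f m n) = f m 0 - f (Suc m) 0"
      by (simp add: algebra_simps)
  qed
  also have "\<dots> = f 0 0" by (rule telescope_infsum_nat[OF col])
  finally show ?thesis .
qed

lemma has_sum_geometric_exp:
  fixes a :: real
  assumes "a > 0"
  shows "((\<lambda>n. exp (- (a * real n))) has_sum 1 / (1 - exp (- a))) UNIV"
proof -
  have "exp (- (a * real n)) = exp (- a) ^ n" for n
    by (simp add: exp_of_nat_mult[symmetric] mult.commute)
  moreover have "(\<lambda>n. exp (- a) ^ n) sums (1 / (1 - exp (- a)))"
    by (rule geometric_sums) (use assms in simp)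
  moreover have "summable (\<lambda>n. norm (exp (- a) ^ n))"
    using assms by (auto simp: norm_power intro!: summable_geometric)
  ultimately show ?thesis
    by (simp add: norm_summable_imp_has_sum)
qed

lemma has_sum_geometric_exp2:
  fixes a b :: real
  assumes "a > 0" "b > 0"
  shows "((\<lambda>(m,n). exp (- (a * real m)) * exp (- (b * real n)))
    has_sum 1 / (1 - exp (- a)) * (1 / (1 - exp (- b)))) UNIV"
proof -
  have 1: "((\<lambda>n. exp (- (a * real m)) * exp (- (b * real n)))
      has_sum exp (- (a * real m)) * (1 / (1 - exp (- b)))) UNIV" for m
    by (intro has_sum_cmult_right has_sum_geometric_exp assms)
  have 2: "((\<lambda>m. exp (- (a * real m)) * (1 / (1 - exp (- b))))
      has_sum 1 / (1 - exp (- a)) * (1 / (1 - exp (- b)))) UNIV"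
    by (intro has_sum_cmult_left has_sum_geometric_exp assms)
  have s: "(\<lambda>(m,n). exp (- (a * real m)) * exp (- (b * real n))) summable_on (SIGMA m:UNIV. UNIV)"
    by (rule summable_on_SigmaI[where g = "\<lambda>m. exp (- (a * real m)) * (1 / (1 - exp (- b)))"])
       (use 1 has_sum_imp_summable[OF 2] in auto)
  have "((\<lambda>(m,n). exp (- (a * real m)) * exp (- (b * real n)))
    has_sum 1 / (1 - exp (- a)) * (1 / (1 - exp (- b)))) (SIGMA m:UNIV. UNIV)"
    by (rule has_sum_SigmaI[OF _ 2 s]) (use 1 in simp)
  then show ?thesis by simp
qed

text \<open>At a = s P this bounds the effective number of cells in one direction by (1 + s P)/(s
  P), so that two directions cost a factor of order 1/s^2.\<close>

lemma geometric_exp_le: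
  fixes a :: real
  assumes "a > 0"
  shows "1 / (1 - exp (- a)) \<le> (1 + a) / a"
proof -
  have "1 + a \<le> exp a" by (rule exp_ge_add_one_self)
  then have "exp (- a) \<le> 1 / (1 + a)"
    using assms by (simp add: exp_minus inverse_eq_divide frac_le)
  also have "\<dots> = 1 - a / (1 + a)" using assms by (simp add: field_simps)
  finally have "a / (1 + a) \<le> 1 - exp (- a)" by simp
  then have "1 / (1 - exp (- a)) \<le> 1 / (a / (1 + a))"
    using assms by (intro divide_left_mono) auto
  then show ?thesis by simp
qed

text \<open>The cubed weight is at least 1, so the Gaussian itself lies below a double geometric
  series; nonnegative offsets p and r only make the exponentials smaller.\<close>

lemma summable_on_gauss_grid:
  fixes A B C :: real
  assumes "A > 0" "B\<^sup>2 < A * C" and "P > 0" "R > 0" "s > 0" "p \<ge> 0" "r \<ge> 0"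
  shows "(\<lambda>(m,n). gauss A B C (s * (real m * P + p)) (s * (real n * R + r))) summable_on UNIV"
proof -
  obtain K where K: "K > 0" "\<And>x y. x \<ge> 0 \<Longrightarrow> y \<ge> 0 \<Longrightarrow>
      ((1 + x) * (1 + y))^3 * gauss A B C x y \<le> K * (exp (- x) * exp (- y))"
    using gauss_decay[OF assms(1,2)] by blast
  have "(\<lambda>(m,n). exp (- (s * P * real m)) * exp (- (s * R * real n))) summable_on UNIV"
    using has_sum_geometric_exp2[of "s * P" "s * R"] assms(3-5) by (auto intro: has_sum_imp_summable)
  then have "(\<lambda>x. K * (case x of (m,n) \<Rightarrow> exp (- (s * P * real m)) * exp (- (s * R * real n)))) summable_on UNIV"
    by (rule summable_on_cmult_right)
  then show ?thesis
  proof (rule summable_on_comparison_test)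
    fix z :: "nat \<times> nat"
    obtain m n where z: "z = (m, n)" by fastforce
    let ?x = "s * (real m * P + p)" and ?y = "s * (real n * R + r)"
    have xy: "?x \<ge> 0" "?y \<ge> 0" using assms(3-7) by auto
    have "1 \<le> ((1 + ?x) * (1 + ?y))"
      using mult_mono[of 1 "1 + ?x" 1 "1 + ?y"] xy by simp
    then have "1 \<le> ((1 + ?x) * (1 + ?y))^3" by (rule one_le_power)
    then have "gauss A B C ?x ?y \<le> ((1 + ?x) * (1 + ?y))^3 * gauss A B C ?x ?y"
      using gauss_pos[of A B C ?x ?y] mult_right_mono[of 1 "((1 + ?x) * (1 + ?y))^3" "gauss A B C ?x ?y"] by simp
    also have "\<dots> \<le> K * (exp (- ?x) * exp (- ?y))" by (rule K(2)[OF xy])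
    also have "\<dots> \<le> K * (exp (- (s * P * real m)) * exp (- (s * R * real n)))"
      using K(1) assms(3-7) by (intro mult_left_mono mult_mono) (auto simp: algebra_simps)
    finally show "(case z of (m,n) \<Rightarrow> gauss A B C (s * (real m * P + p)) (s * (real n * R + r)))
      \<le> K * (case z of (m,n) \<Rightarrow> exp (- (s * P * real m)) * exp (- (s * R * real n)))"
      by (simp add: z)
  qed (auto simp: less_imp_le[OF gauss_pos])
qed

lemma infsum_diff2_gauss:
  fixes A B C :: real
  assumes "A > 0" "B\<^sup>2 < A * C" and "P > 0" "R > 0" "s > 0" "p \<ge> 0" "r \<ge> 0"
  defines "T \<equiv> \<lambda>p r. \<Sum>\<^sub>\<infinity>(m,n). gauss A B C (s * (real m * P + p)) (s * (real n * R + r))"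
  shows "((\<lambda>(m,n). diff2 (gauss A B C) (s * (real m * P)) (s * (real n * R)) (s * p) (s * r))
    has_sum (T p r - T 0 r - T p 0 + T 0 0)) UNIV"
proof -
  have h: "((\<lambda>(m,n). gauss A B C (s * (real m * P + p)) (s * (real n * R + r))) has_sum T p r) UNIV"
    if "p \<ge> 0" "r \<ge> 0" for p r
    unfolding T_def using summable_on_gauss_grid[OF assms(1-5) that] by (rule has_sum_infsum)
  have "((\<lambda>z. (case z of (m,n) \<Rightarrow> gauss A B C (s * (real m * P + p)) (s * (real n * R + r)))
     - (case z of (m,n) \<Rightarrow> gauss A B C (s * (real m * P + 0)) (s * (real n * R + r)))
     - (case z of (m,n) \<Rightarrow> gauss A B C (s * (real m * P + p)) (s * (real n * R + 0)))
     + (case z of (m,n) \<Rightarrow> gauss A B C (s * (real m * P + 0)) (s * (real n * R + 0))))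
     has_sum (T p r - T 0 r - T p 0 + T 0 0)) UNIV"
    using assms(6,7) by (intro has_sum_add has_sum_minus h) auto
  then show ?thesis
    by (simp add: diff2_def case_prod_unfold distrib_left)
qed

lemma infsum_diff2_gauss_full:
  fixes A B C :: real
  assumes "A > 0" "B\<^sup>2 < A * C" and "P > 0" "R > 0" "s > 0"
  shows "((\<lambda>(m,n). diff2 (gauss A B C) (s * (real m * P)) (s * (real n * R)) (s * P) (s * R))
    has_sum 1) UNIV"
proof -
  let ?f = "\<lambda>m n. gauss A B C (s * (real m * P)) (s * (real n * R))"
  have "(\<lambda>(m,n). ?f m n) summable_on UNIV"
    using summable_on_gauss_grid[OF assms, of 0 0] by simp
  from telescope_infsum_nat2[OF this]
  have *: "(\<Sum>\<^sub>\<infinity>(m,n). ?f (Suc m) (Suc n) - ?f m (Suc n) - ?f (Suc m) n + ?f m n) = 1"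
    by (simp add: gauss_def)
  have eq: "(\<lambda>(m,n). diff2 (gauss A B C) (s * (real m * P)) (s * (real n * R)) (s * P) (s * R))
    = (\<lambda>(m,n). ?f (Suc m) (Suc n) - ?f m (Suc n) - ?f (Suc m) n + ?f m n)"
    by (intro ext) (auto simp: diff2_def algebra_simps)
  show ?thesis
    \<comment> \<open>The case p = P, r = R of the previous lemma is used for convergence only; the
      value 1 comes from telescoping.\<close>
    using has_sum_infsum[OF has_sum_imp_summable[OF infsum_diff2_gauss[of A B C P R s P R]]]
      assms * by (simp add: eq)
qed

text \<open>The full-cell differences have sum exactly 1, so only the deviation from proportionality
  must tend to 0. It is at most K s^3 P R (P + R) times the double geometric series, and the latter
  is at most (1 + s P)(1 + s R)/(s^2 P R).\<close>

lemma gauss_cell_sum_limit: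
  fixes A B C :: real
  assumes "A > 0" "B\<^sup>2 < A * C" and P: "0 \<le> p" "p \<le> P" "0 < P" and R: "0 \<le> r" "r \<le> R" "0 < R"
  defines "T \<equiv> \<lambda>s p r. \<Sum>\<^sub>\<infinity>(m,n). gauss A B C (s * (real m * P + p)) (s * (real n * R + r))"
  shows "((\<lambda>s. T s p r - T s 0 r - T s p 0 + T s 0 0) \<longlongrightarrow> p * r / (P * R)) (at_right 0)"
proof -
  obtain K where K: "K > 0"
    "\<And>x y u v U V. 0 \<le> x \<Longrightarrow> 0 \<le> y \<Longrightarrow> 0 \<le> u \<Longrightarrow> u \<le> U \<Longrightarrow> 0 \<le> v \<Longrightarrow> v \<le> V \<Longrightarrow> 0 < U \<Longrightarrow> 0 < V \<Longrightarrow>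
       \<bar>diff2 (gauss A B C) x y u v - u * v / (U * V) * diff2 (gauss A B C) x y U V\<bar>
         \<le> K * (U * V * (U + V)) * (exp (- x) * exp (- y))"
    using diff2_gauss_proportional[OF assms(1,2)] by blast
  have bound: "\<bar>T s p r - T s 0 r - T s p 0 + T s 0 0 - p * r / (P * R)\<bar>
      \<le> K * (s * (P + R)) * ((1 + s * P) * (1 + s * R))" if s: "s > 0" for s
  proof -
    let ?D = "\<lambda>u v z. (case z of (m,n) \<Rightarrow> diff2 (gauss A B C) (s * (real m * P)) (s * (real n * R)) (s * u) (s * v))"
    have 1: "((\<lambda>z. ?D p r z - p * r / (P * R) * ?D P R z) has_sum
      (T s p r - T s 0 r - T s p 0 + T s 0 0 - p * r / (P * R) * 1)) UNIV"
      unfolding T_def using s assms(1-8)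
      by (intro has_sum_minus has_sum_cmult_right infsum_diff2_gauss infsum_diff2_gauss_full)
    let ?K = "K * ((s * P) * (s * R) * (s * P + s * R))"
    have 2: "((\<lambda>z. ?K * (case z of (m,n) \<Rightarrow> exp (- (s * P * real m)) * exp (- (s * R * real n))))
      has_sum ?K * (1 / (1 - exp (- (s * P))) * (1 / (1 - exp (- (s * R)))))) UNIV"
      using s P R by (intro has_sum_cmult_right has_sum_geometric_exp2) auto
    have "norm (T s p r - T s 0 r - T s p 0 + T s 0 0 - p * r / (P * R) * 1)
      \<le> ?K * (1 / (1 - exp (- (s * P))) * (1 / (1 - exp (- (s * R)))))"
    proof (rule norm_infsum_le[OF 1 2])
      fix z :: "nat \<times> nat"
      obtain m n where z: "z = (m, n)" by fastforce
      have "\<bar>diff2 (gauss A B C) (s * (real m * P)) (s * (real n * R)) (s * p) (s * r)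
          - (s * p) * (s * r) / ((s * P) * (s * R)) *
            diff2 (gauss A B C) (s * (real m * P)) (s * (real n * R)) (s * P) (s * R)\<bar>
        \<le> ?K * (exp (- (s * (real m * P))) * exp (- (s * (real n * R))))"
        using s P R by (intro K(2)) auto
      moreover have "(s * p) * (s * r) / ((s * P) * (s * R)) = p * r / (P * R)"
        using s by simp
      ultimately show "norm (?D p r z - p * r / (P * R) * ?D P R z)
        \<le> ?K * (case z of (m,n) \<Rightarrow> exp (- (s * P * real m)) * exp (- (s * R * real n)))"
        by (simp add: z mult.commute mult.left_commute)
    qed
    also have "\<dots> \<le> ?K * ((1 + s * P) / (s * P) * ((1 + s * R) / (s * R)))"
      using s P R K(1) by (intro mult_left_mono mult_mono geometric_exp_le) auto
    also have "\<dots> = K * (s * (P + R)) * ((1 + s * P) * (1 + s * R))"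
      using s P R by (simp add: field_simps)
    finally show ?thesis by simp
  qed
  have "((\<lambda>s. K * (s * (P + R)) * ((1 + s * P) * (1 + s * R))) \<longlongrightarrow>
     K * (0 * (P + R)) * ((1 + 0 * P) * (1 + 0 * R))) (at_right 0)"
    by (intro tendsto_intros)
  then have lim: "((\<lambda>s. K * (s * (P + R)) * ((1 + s * P) * (1 + s * R))) \<longlongrightarrow> 0) (at_right 0)"
    by simp
  have "((\<lambda>s. T s p r - T s 0 r - T s p 0 + T s 0 0 - p * r / (P * R)) \<longlongrightarrow> 0) (at_right 0)"
    by (rule Lim_null_comparison[OF _ lim]) (auto simp: eventually_at_right_less bound
      intro!: eventually_mono[OF eventually_at_right_less])
  then show ?thesis by (simp add: LIM_zero_iff)
qed

section \<open>Assembling the residue classes of a periodic weight\<close>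

lemma infsum_residues:
  fixes f :: "nat \<times> nat \<Rightarrow> complex"
  assumes f: "f summable_on UNIV" and "P > 0" "R > 0"
  shows "infsum f UNIV = (\<Sum>p<P. \<Sum>r<R. \<Sum>\<^sub>\<infinity>(m,n). f (m * P + p, n * R + r))"
proof -
  let ?h = "\<lambda>((p,r),(m,n)). (m * P + p, n * R + r)"
  let ?X = "({..<P} \<times> {..<R}) \<times> (UNIV :: (nat \<times> nat) set)"
  have bij: "bij_betw ?h ?X UNIV"
    by (rule bij_betw_byWitness[where f' = "\<lambda>(i,j). ((i mod P, j mod R), (i div P, j div R))"])
       (use assms(2,3) in auto)
  have "infsum f UNIV = infsum (\<lambda>x. f (?h x)) ?X"
    by (rule infsum_reindex_bij_betw[OF bij, symmetric])
  also have "\<dots> = (\<Sum>\<^sub>\<infinity>x\<in>{..<P} \<times> {..<R}. \<Sum>\<^sub>\<infinity>y. f (?h (x, y)))"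
  proof (rule infsum_Sigma_banach[symmetric])
    show "(\<lambda>x. f (?h x)) summable_on ?X"
      using f summable_on_reindex_bij_betw[OF bij, of f] by simp
  qed
  also have "\<dots> = (\<Sum>x\<in>{..<P} \<times> {..<R}. \<Sum>\<^sub>\<infinity>y. f (?h (x, y)))"
    by (rule infsum_finite) simp
  also have "\<dots> = (\<Sum>p<P. \<Sum>r<R. \<Sum>\<^sub>\<infinity>(m,n). f (m * P + p, n * R + r))"
    by (simp add: sum.cartesian_product case_prod_unfold)
  finally show ?thesis .
qed

lemma periodic_gauss_sum_limit:
  fixes G :: "nat \<Rightarrow> nat \<Rightarrow> complex" and A B C :: real
  assumes AC: "A > 0" "B\<^sup>2 < A * C" and PR: "P > 0" "R > 0"
    and per: "\<And>i j. G i j = G (i mod P) (j mod R)"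
    and rows: "\<And>i. (\<Sum>j<R. G i j) = 0" and cols: "\<And>j. (\<Sum>i<P. G i j) = 0"
  shows "((\<lambda>s. \<Sum>\<^sub>\<infinity>(i,j). G i j * of_real (gauss A B C (s * real i) (s * real j))) \<longlongrightarrow>
    (\<Sum>p<P. \<Sum>r<R. G p r * of_real (real p * real r / (real P * real R)))) (at_right 0)"
proof -
  define T where "T = (\<lambda>s p r. \<Sum>\<^sub>\<infinity>(m,n). gauss A B C (s * (real m * real P + p)) (s * (real n * real R + r)))"
  have PR': "real P > 0" "real R > 0" using PR by auto
  have eq: "(\<Sum>\<^sub>\<infinity>(i,j). G i j * of_real (gauss A B C (s * real i) (s * real j)))
    = (\<Sum>p<P. \<Sum>r<R. G p r * of_real (T s (real p) (real r) - T s 0 (real r) - T s (real p) 0 + T s 0 0))"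
    if s: "s > 0" for s
  proof -
    \<comment> \<open>A crude bound for the periodic weight, sufficient for absolute convergence and
      hence for splitting the sum into residue classes.\<close>
    define b where "b = (\<Sum>p<P. \<Sum>r<R. norm (G p r))"
    have b: "norm (G i j) \<le> b" for i j
    proof -
      have "norm (G i j) = norm (G (i mod P) (j mod R))" using per[of i j] by simp
      also have "\<dots> \<le> (\<Sum>r<R. norm (G (i mod P) r))"
        using PR by (intro member_le_sum) auto
      also have "\<dots> \<le> b"
        unfolding b_def using PR by (intro member_le_sum[of _ _ "\<lambda>p. \<Sum>r<R. norm (G p r)"]) (auto intro: sum_nonneg)
      finally show ?thesis .
    qed
    have sg: "(\<lambda>(i,j). gauss A B C (s * real i) (s * real j)) summable_on UNIV"
      using summable_on_gauss_grid[OF AC, of 1 1 s 0 0] s by simp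
    have "(\<lambda>x. b * (case x of (i,j) \<Rightarrow> gauss A B C (s * real i) (s * real j))) summable_on UNIV"
      using sg by (rule summable_on_cmult_right)
    then have sf: "(\<lambda>(i,j). G i j * of_real (gauss A B C (s * real i) (s * real j))) summable_on UNIV"
    proof (rule abs_summable_summable[OF summable_on_comparison_test])
      show "norm (case x of (i,j) \<Rightarrow> G i j * complex_of_real (gauss A B C (s * real i) (s * real j)))
        \<le> b * (case x of (i,j) \<Rightarrow> gauss A B C (s * real i) (s * real j))" for x
        by (cases x) (auto simp: norm_mult less_imp_le[OF gauss_pos] intro!: mult_mono b order_trans[OF norm_ge_zero b])
    qed auto
    have "(\<Sum>\<^sub>\<infinity>(i,j). G i j * of_real (gauss A B C (s * real i) (s * real j)))
      = (\<Sum>p<P. \<Sum>r<R. \<Sum>\<^sub>\<infinity>(m,n). G (m * P + p) (n * R + r) *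
          of_real (gauss A B C (s * real (m * P + p)) (s * real (n * R + r))))"
      using infsum_residues[OF sf PR] by simp
    also have "\<dots> = (\<Sum>p<P. \<Sum>r<R. G p r * of_real (T s p r))"
    proof (intro sum.cong refl)
      fix p r assume pr: "p \<in> {..<P}" "r \<in> {..<R}"
      have Gpr: "G (m * P + p) (n * R + r) = G p r" for m n
        using pr per[of "m * P + p" "n * R + r"] by simp
      have "((\<lambda>(m,n). gauss A B C (s * (real m * real P + real p)) (s * (real n * real R + real r)))
          has_sum T s p r) UNIV"
        unfolding T_def using s PR' by (intro has_sum_infsum summable_on_gauss_grid AC) auto
      then have "((\<lambda>z. G p r * of_real (case z of (m,n) \<Rightarrow>
          gauss A B C (s * (real m * real P + real p)) (s * (real n * real R + real r))))
          has_sum G p r * of_real (T s p r)) UNIV"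
        by (intro has_sum_cmult_right has_sum_of_real)
      then show "(\<Sum>\<^sub>\<infinity>(m,n). G (m * P + p) (n * R + r) *
          of_real (gauss A B C (s * real (m * P + p)) (s * real (n * R + r)))) = G p r * of_real (T s p r)"
        by (intro infsumI) (simp add: Gpr case_prod_unfold)
    qed
    \<comment> \<open>The three inserted sums are zero: \<open>T s 0 r\<close> does not depend on p
      and is killed by the column sums, \<open>T s p 0\<close> by the row sums, and the constant
      \<open>T s 0 0\<close> by either.\<close>
    also have "\<dots> = (\<Sum>p<P. \<Sum>r<R. G p r * of_real (T s p r))
       - (\<Sum>p<P. \<Sum>r<R. G p r * of_real (T s 0 r)) - (\<Sum>p<P. \<Sum>r<R. G p r * of_real (T s p 0))
       + (\<Sum>p<P. \<Sum>r<R. G p r * of_real (T s 0 0))"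
    proof -
      have "(\<Sum>p<P. \<Sum>r<R. G p r * of_real (T s 0 r)) = 0"
        by (subst sum.swap) (simp add: cols flip: sum_distrib_right)
      moreover have "(\<Sum>p<P. \<Sum>r<R. G p r * of_real (T s p 0)) = 0"
        by (simp add: rows flip: sum_distrib_right)
      moreover have "(\<Sum>p<P. \<Sum>r<R. G p r * of_real (T s 0 0)) = 0"
        by (simp add: rows flip: sum_distrib_right)
      ultimately show ?thesis by simp
    qed
    finally show ?thesis
      by (simp add: sum_subtractf sum.distrib distrib_left right_diff_distrib)
  qed
  have "((\<lambda>s. \<Sum>p<P. \<Sum>r<R. G p r * of_real (T s (real p) (real r) - T s 0 (real r) - T s (real p) 0 + T s 0 0))
    \<longlongrightarrow> (\<Sum>p<P. \<Sum>r<R. G p r * of_real (real p * real r / (real P * real R)))) (at_right 0)"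
    unfolding T_def using PR'
    by (intro tendsto_sum tendsto_mult_left tendsto_of_real gauss_cell_sum_limit AC) auto
  then show ?thesis
    by (rule Lim_transform_eventually)
       (auto intro!: eventually_mono[OF eventually_at_right_less[of 0]] simp: eq)
qed

subsection \<open>Vanishing of twisted sums\<close>

lemma ee_add: "ee (x + y) = ee x * ee y"
  by (simp add: ee_def distrib_left exp_add)

lemma ee_of_real_eq_1_iff: "ee (of_real x) = 1 \<longleftrightarrow> x \<in> \<int>"
proof -
  have "ee (of_real x) = 1 \<longleftrightarrow> (\<exists>n::int. 2 * pi * x = of_int (2 * n) * pi)"
    by (simp add: ee_def exp_eq_1)
  also have "\<dots> \<longleftrightarrow> (\<exists>n::int. x = of_int n)" by (simp add: field_simps)
  also have "\<dots> \<longleftrightarrow> x \<in> \<int>" by (auto simp: Ints_def)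
  finally show ?thesis .
qed

lemma ee_of_real_cong:
  assumes "x - y \<in> \<int>"
  shows "ee (of_real x) = ee (of_real y)"
  using ee_add[of "of_real (x - y)" "of_real y"] assms ee_of_real_eq_1_iff[of "x - y"] by simp

lemma of_int_divide_in_Ints_iff:
  fixes m n :: int
  assumes "n \<noteq> 0"
  shows "of_int m / of_int n \<in> (\<int> :: real set) \<longleftrightarrow> n dvd m"
proof
  assume "of_int m / of_int n \<in> (\<int> :: real set)"
  then obtain z where "of_int m / of_int n = (of_int z :: real)" by (auto simp: Ints_def)
  then have "(of_int m :: real) = of_int (z * n)" using assms by (simp add: field_simps)
  then have "m = z * n" by (simp only: of_int_eq_iff)
  then show "n dvd m" by simp
next
  assume "n dvd m"
  then obtain z where "m = n * z" ..
  then show "of_int m / of_int n \<in> (\<int> :: real set)" using assms by simp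
qed

lemma sum_periodic_shift:
  fixes F :: "int \<Rightarrow> complex"
  assumes "k > 0" and F: "\<And>i j. k dvd i - j \<Longrightarrow> F i = F j"
  shows "(\<Sum>j\<in>{0..<k}. F (j + l)) = (\<Sum>j\<in>{0..<k}. F j)"
proof (rule sum.reindex_bij_witness[of _ "\<lambda>j. (j - l) mod k" "\<lambda>j. (j + l) mod k"])
  fix j
  show "F ((j + l) mod k) = F (j + l)"
    by (rule F) (simp add: mod_eq_dvd_iff[symmetric])
  assume "j \<in> {0..<k}"
  then show "((j + l) mod k - l) mod k = j" "((j - l) mod k + l) mod k = j"
    by (simp_all add: mod_simps)
qed (use assms in auto)

lemma sum_residue_blocks:
  fixes f :: "int \<Rightarrow> complex"
  assumes "m > 0" "k > 0"
  shows "(\<Sum>r\<in>{0..<m*k}. f r) = (\<Sum>r\<in>{0..<m}. \<Sum>j\<in>{0..<k}. f (r + m * j))"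
proof -
  have "(\<Sum>r\<in>{0..<m}. \<Sum>j\<in>{0..<k}. f (r + m * j)) = (\<Sum>(r,j)\<in>{0..<m}\<times>{0..<k}. f (r + m * j))"
    by (rule sum.cartesian_product)
  also have "\<dots> = (\<Sum>r\<in>{0..<m*k}. f r)"
  proof (rule sum.reindex_bij_witness[of _ "\<lambda>x. (x mod m, x div m)" "\<lambda>(r,j). r + m * j"])
    fix z assume z: "z \<in> {0..<m}\<times>{0..<k}"
    obtain r j where rj: "z = (r, j)" by fastforce
    have "r + m * j < m + m * j" using z rj by simp
    also have "\<dots> = m * (j + 1)" by (simp add: algebra_simps)
    also have "\<dots> \<le> m * k" using z rj assms by (intro mult_left_mono) auto
    finally show "(case z of (r,j) \<Rightarrow> r + m * j) \<in> {0..<m*k}" using z rj assms by simp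
  next
    fix x assume x: "x \<in> {0..<m*k}"
    have "m * (x div m) \<le> x"
      using mult_div_mod_eq[of m x] pos_mod_sign[of m x] assms by linarith
    also have "\<dots> < m * k" using x by simp
    finally have "x div m < k" using assms by simp
    then show "(x mod m, x div m) \<in> {0..<m}\<times>{0..<k}"
      using assms x by (simp add: pos_imp_zdiv_nonneg_iff)
  qed (use assms in auto)
  finally show ?thesis by simp
qed

text \<open>The exponent is the part of (h/k) Q(\<gamma>) that depends on r when the other numerator
  p is fixed. Writing residues mod 2Nk as r + 2N j makes the sum equal to that of
  \<open>Y r * I r\<close> over r mod 2N. As Y sums to 0, one common value of I on the support of Y
  is enough. With M, a in place of N, c the same lemma serves the columns.\<close>

lemma twisted_sum_eq_0:
  fixes h k N b c p :: int and Y :: "int \<Rightarrow> complex"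
  assumes "k > 0" "N > 0" and hk: "coprime h k" and cN: "coprime c N"
    and per: "\<And>i j. 2 * N dvd i - j \<Longrightarrow> Y i = Y j"
    and sum0: "(\<Sum>r\<in>{0..<2*N}. Y r) = 0"
    and cop: "\<And>r. Y r \<noteq> 0 \<Longrightarrow> coprime r (2 * N)"
    and sq: "\<And>r r'. Y r \<noteq> 0 \<Longrightarrow> Y r' \<noteq> 0 \<Longrightarrow> 4 * N dvd r\<^sup>2 - r'\<^sup>2"
  shows "(\<Sum>r\<in>{0..<2*N*k}. Y r * ee (of_real (of_int h / of_int k *
     (of_int b * of_int p * of_int r / 2 + of_int c * (of_int r)\<^sup>2 / (4 * of_int N))))) = 0"
proof -
  define \<phi> where "\<phi> r = ee (of_real (of_int h / of_int k *
     (of_int b * of_int p * of_int r / 2 + of_int c * (of_int r)\<^sup>2 / (4 * of_int N))))" for r :: int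
  define I where "I r = (\<Sum>j\<in>{0..<k}. \<phi> (r + 2 * N * j))" for r
  have phi_mult: "\<phi> r = \<phi> r' * ee (of_real x)"
    \<comment> \<open>The quotient is the difference of the two exponents over the common
      denominator 4Nk. It is used with x = 0 for equal phases and with x = hcr/g for the nontrivial
      factor.\<close>
    if "of_int (h * (2 * N * b * p * (r - r') + c * (r\<^sup>2 - r'\<^sup>2))) / of_int (4 * N * k) - x \<in> \<int>"
    for r r' x
  proof -
    let ?e = "\<lambda>r::int. of_int h / of_int k *
     (of_int b * of_int p * of_int r / 2 + of_int c * (of_int r)\<^sup>2 / (4 * of_int N)) :: real"
    have "?e r - ?e r' = of_int (h * (2 * N * b * p * (r - r') + c * (r\<^sup>2 - r'\<^sup>2))) / of_int (4 * N * k)"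
      using assms(1,2) by (simp add: field_simps)
    then have "?e r - (?e r' + x) \<in> \<int>" using that by (simp only: diff_diff_eq[symmetric])
    then have "ee (of_real (?e r)) = ee (of_real (?e r' + x))" by (rule ee_of_real_cong)
    then show ?thesis by (simp only: \<phi>_def of_real_add ee_add)
  qed
  have phi_eq: "\<phi> r = \<phi> r'" if "4 * N * k dvd h * (2 * N * b * p * (r - r') + c * (r\<^sup>2 - r'\<^sup>2))" for r r'
  proof -
    have "of_int (h * (2 * N * b * p * (r - r') + c * (r\<^sup>2 - r'\<^sup>2))) / of_int (4 * N * k) \<in> (\<int>::real set)"
      using that assms(1,2) by (subst of_int_divide_in_Ints_iff) auto
    then show ?thesis using phi_mult[of r r' 0] by (simp add: ee_def)
  qed
  \<comment> \<open>Despite the denominator 4Nk, the period is 2Nk: a step 2Nkz changes the square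
    by 4Nkz(r' + Nkz), and the linear term also gains the missing factor 2.\<close>
  have phi_per: "\<phi> r = \<phi> r'" if dv: "2 * N * k dvd r - r'" for r r'
  proof (rule phi_eq)
    obtain z where z: "r - r' = 2 * N * k * z" using dv ..
    then have "r = r' + 2 * N * k * z" by simp
    then have "h * (2 * N * b * p * (r - r') + c * (r\<^sup>2 - r'\<^sup>2))
      = 4 * N * k * (h * (N * b * p * z + c * z * (r' + N * k * z)))"
      by (simp add: algebra_simps power2_eq_square)
    then show "4 * N * k dvd h * (2 * N * b * p * (r - r') + c * (r\<^sup>2 - r'\<^sup>2))" by (rule dvdI)
  qed
  have I_shift: "I (r + 2 * N * l) = I r" for r l
  proof -
    have "(\<Sum>j\<in>{0..<k}. \<phi> (r + 2 * N * (j + l))) = (\<Sum>j\<in>{0..<k}. \<phi> (r + 2 * N * j))"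
    proof (rule sum_periodic_shift[OF assms(1), where F = "\<lambda>j. \<phi> (r + 2 * N * j)"])
      fix i j assume "k dvd i - j"
      then have "2 * N * k dvd 2 * N * (i - j)" by (rule mult_dvd_mono[OF dvd_refl])
      then show "\<phi> (r + 2 * N * i) = \<phi> (r + 2 * N * j)" by (intro phi_per) (simp add: algebra_simps)
    qed
    then show ?thesis by (simp add: I_def algebra_simps)
  qed
  have main: "(\<Sum>r\<in>{0..<2*N*k}. Y r * \<phi> r) = (\<Sum>r\<in>{0..<2*N}. Y r * I r)"
  proof -
    have "Y (r + 2 * N * j) = Y r" for r j by (rule per) simp
    then show ?thesis
      using assms(1,2) by (subst sum_residue_blocks) (auto simp: I_def sum_distrib_left)
  qed
  have "\<exists>I0. \<forall>r. Y r \<noteq> 0 \<longrightarrow> I r = I0"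
  proof (cases "coprime N k")
    case True
    \<comment> \<open>Any two odd residues mod \<open>2N\<close> have representatives that agree mod \<open>2k\<close>.\<close>
    obtain u v where "u * N + v * k = gcd N k" using bezout_int by blast
    then have uv: "u * N + v * k = 1" using True by simp
    have "I r = I r'" if Y: "Y r \<noteq> 0" "Y r' \<noteq> 0" for r r'
    proof -
      have "odd r" "odd r'" using cop[OF Y(1)] cop[OF Y(2)] by auto
      then obtain d where d: "r - r' = 2 * d" by (metis even_diff dvdE odd_even_add even_add)
      obtain w0 where w0: "r\<^sup>2 - r'\<^sup>2 = 4 * N * w0" using sq[OF Y] ..
      \<comment> \<open>From uN + vk = 1 one gets d + N l = k d v. Hence r + 2N l - r' = 2(d + N l)
        is a multiple of 2k.\<close>
      define l where "l = - d * u"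
      have l: "N * l + d = k * (d * v)"
      proof -
        have "N * l + d = d * (1 - u * N)" by (simp add: l_def algebra_simps)
        also have "1 - u * N = v * k" using uv by simp
        finally show ?thesis by (simp add: algebra_simps)
      qed
      have "I r = I (r + 2 * N * l)" by (simp add: I_shift)
      also have "\<dots> = I r'"
        unfolding I_def
      proof (intro sum.cong refl phi_eq)
        fix j
        \<comment> \<open>The difference of the squares is divisible by 4N by hypothesis, and by 4k
          because s - s' is a multiple of 2k and s + s' is even. Coprimality of N and k combines
          these to 4Nk; the linear term has this divisor as well.\<close>
        define s s' where "s = r + 2 * N * l + 2 * N * j" and "s' = r' + 2 * N * j"
        have ss: "s - s' = 2 * k * (d * v)"
          using d l by (simp add: s_def s'_def algebra_simps)
        have "s\<^sup>2 - s'\<^sup>2 = (r\<^sup>2 - r'\<^sup>2) + 4 * N * ((l + j) * (r + N * (l + j)) - j * (r' + N * j))"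
          by (simp add: s_def s'_def algebra_simps power2_eq_square)
        then obtain w1 where w1: "s\<^sup>2 - s'\<^sup>2 = 4 * (N * w1)"
          using w0 by (metis distrib_left mult.assoc)
        have "s + s' = 2 * (s' + k * (d * v))" using ss by simp
        moreover have "s\<^sup>2 - s'\<^sup>2 = (s - s') * (s + s')" by (simp add: power2_eq_square algebra_simps)
        ultimately have "s\<^sup>2 - s'\<^sup>2 = 4 * (k * (d * v * (s' + k * (d * v))))"
          using ss by (simp add: algebra_simps)
        with w1 have "N * w1 = k * (d * v * (s' + k * (d * v)))" by linarith
        then have "k dvd N * w1" by simp
        then have "k dvd w1" using True by (simp add: coprime_dvd_mult_right_iff coprime_commute)
        then obtain w2 where "w1 = k * w2" ..
        with w1 have sq2: "s\<^sup>2 - s'\<^sup>2 = 4 * N * k * w2" by (simp add: mult.assoc)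
        have "h * (2 * N * b * p * (s - s') + c * (s\<^sup>2 - s'\<^sup>2)) = 4 * N * k * (h * (b * p * (d * v) + c * w2))"
          unfolding ss sq2 by (simp add: algebra_simps)
        then show "4 * N * k dvd h * (2 * N * b * p * (r + 2 * N * l + 2 * N * j - (r' + 2 * N * j))
            + c * ((r + 2 * N * l + 2 * N * j)\<^sup>2 - (r' + 2 * N * j)\<^sup>2))"
          unfolding s_def s'_def by (rule dvdI)
      qed
      finally show ?thesis .
    qed
    then show ?thesis by blast
  next
    case False
    \<comment> \<open>Shifting the summation index by \<open>k/g\<close> multiplies the inner sum by \<open>e(hcr/g) \<noteq> 1\<close>.\<close>
    define g where "g = gcd N k"
    have g: "g > 1" using False assms(1,2) 
      by (smt (verit) g_def coprime_iff_gcd_eq_1 gcd_pos_int)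
    obtain N' where N': "N = g * N'" unfolding g_def by (metis gcd_dvd1 dvdE)
    obtain k' where k': "k = g * k'" unfolding g_def by (metis gcd_dvd2 dvdE)
    have k'0: "k' \<noteq> 0" "g \<noteq> 0" "N \<noteq> 0" using k' assms(1,2) g by auto
    have "I r = 0" if Y: "Y r \<noteq> 0" for r
    proof -
      define \<omega> where "\<omega> = ee (of_real (of_int (h * c * r) / of_int g))"
      \<comment> \<open>As g divides both k and N, each of h, c and r is coprime to g. Since g > 1,
        the quotient hcr/g is not an integer.\<close>
      have "coprime h g" using hk k' by (metis coprime_mult_right_iff)
      moreover have "coprime c g" using cN N' by (metis coprime_mult_right_iff)
      moreover have "coprime r g" using cop[OF Y] N' by (metis coprime_mult_right_iff)
      ultimately have "coprime (h * c * r) g" by simp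
      then have "\<not> g dvd h * c * r"
        using g coprime_common_divisor[of "h * c * r" g g] by auto
      then have w1: "\<omega> \<noteq> 1"
        unfolding \<omega>_def ee_of_real_eq_1_iff using k'0 by (subst of_int_divide_in_Ints_iff) auto
      have step: "\<phi> (r + 2 * N * k' + 2 * N * j) = \<phi> (r + 2 * N * j) * \<omega>" for j
        unfolding \<omega>_def
      proof (rule phi_mult)
        \<comment> \<open>The shift changes the square by 4Nk'(r + 2N j + Nk'). Since N = gN', every
          contribution except hcr has a further factor g and so adds only an integer to the
          exponent.\<close>
        let ?s = "r + 2 * N * k' + 2 * N * j" and ?s' = "r + 2 * N * j"
        have "h * (2 * N * b * p * (?s - ?s') + c * (?s\<^sup>2 - ?s'\<^sup>2))
          = 4 * N * k' * (h * c * r + g * (h * (b * p * N' + c * (2 * N' * j + N' * k'))))"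
          by (simp add: N' algebra_simps power2_eq_square)
        then have "of_int (h * (2 * N * b * p * (?s - ?s') + c * (?s\<^sup>2 - ?s'\<^sup>2))) / of_int (4 * N * k)
          = (of_int (4 * N * k') * of_int (h * c * r + g * (h * (b * p * N' + c * (2 * N' * j + N' * k'))))
            / (of_int (4 * N * k') * of_int g) :: real)"
          by (simp only: k' of_int_mult mult_ac)
        also have "\<dots> = of_int (h * c * r + g * (h * (b * p * N' + c * (2 * N' * j + N' * k')))) / of_int g"
          using k'0 by (intro mult_divide_mult_cancel_left) auto
        also have "\<dots> = of_int (h * c * r) / of_int g + of_int (h * (b * p * N' + c * (2 * N' * j + N' * k')))"
          using k'0 by (simp only: of_int_add of_int_mult add_divide_distrib) simp
        finally show "of_int (h * (2 * N * b * p * (?s - ?s') + c * (?s\<^sup>2 - ?s'\<^sup>2))) / of_int (4 * N * k)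
          - of_int (h * c * r) / of_int g \<in> (\<int>::real set)"
          by (simp only: add_diff_cancel_left' Ints_of_int)
      qed
      have "I r = I (r + 2 * N * k')" by (simp add: I_shift)
      also have "\<dots> = I r * \<omega>" unfolding I_def by (simp add: step sum_distrib_right)
      finally show "I r = 0" using w1 by simp
    qed
    then show ?thesis by blast
  qed
  then obtain I0 where I0: "\<And>r. Y r \<noteq> 0 \<Longrightarrow> I r = I0" by blast
  have "(\<Sum>r\<in>{0..<2*N}. Y r * I r) = (\<Sum>r\<in>{0..<2*N}. Y r * I0)"
    by (intro sum.cong refl) (use I0 in auto)
  also have "\<dots> = 0" using sum0 by (simp flip: sum_distrib_right)
  finally show ?thesis using main by (simp add: \<phi>_def)
qed

section \<open>From coset sums to sums over residues\<close>

lemma quotient_sum_frac_multiples: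
  fixes m :: int
  assumes m: "m > 0" and f: "factors_through (frac_multiples m) \<int> f"
  shows "quotient_sum (frac_multiples m) \<int> f = (\<Sum>r\<in>{0..<m}. f (of_int r / of_int m))"
proof -
  let ?L = "frac_multiples m"
  define E where "E = {(x, y). x \<in> ?L \<and> y \<in> ?L \<and> x - y \<in> \<int>}"
  define C where "C r = E `` {of_int r / of_int m}" for r :: int
  have L: "of_int r / of_int m \<in> ?L" for r
    unfolding frac_multiples_def by (rule rangeI)
  have d: "of_int r / of_int m - of_int r' / of_int m \<in> (\<int>::real set) \<longleftrightarrow> m dvd r - r'" for r r'
    using of_int_divide_in_Ints_iff[of m "r - r'"] m by (simp add: diff_divide_distrib)
  have memC: "of_int r' / of_int m \<in> C r \<longleftrightarrow> m dvd r - r'" for r r'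
    using L by (simp add: C_def E_def d)
  have C_eq: "C r = C r'" if "m dvd r - r'" for r r'
  proof -
    have *: "of_int r / of_int m - of_int r' / of_int m \<in> (\<int>::real set)" using that d by simp
    have "of_int r / of_int m - y \<in> \<int> \<longleftrightarrow> of_int r' / of_int m - y \<in> \<int>" for y :: real
      using Ints_diff[OF _ *, of "of_int r / of_int m - y"] Ints_add[OF _ *, of "of_int r' / of_int m - y"]
      by auto
    then show ?thesis using L by (auto simp: C_def E_def)
  qed
  have "?L // E = range C"
    by (auto simp: quotient_def frac_multiples_def C_def)
  also have "\<dots> = C ` {0..<m}"
  proof -
    have "C r \<in> C ` {0..<m}" for r
    proof (rule image_eqI)
      show "C r = C (r mod m)" by (rule C_eq) (simp add: dvd_minus_mod)
    qed (use m in simp)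
    then show ?thesis by auto
  qed
  finally have q: "?L // E = C ` {0..<m}" .
  have inj: "inj_on C {0..<m}"
  proof (rule inj_onI)
    fix r r' assume r: "r \<in> {0..<m}" "r' \<in> {0..<m}" "C r = C r'"
    have "of_int r / of_int m \<in> C r'" using memC[of r r] r(3) by simp
    then have "m dvd r' - r" by (simp add: memC)
    then have "r' mod m = r mod m" by (simp add: mod_eq_dvd_iff)
    then show "r = r'" using r by simp
  qed
  \<comment> \<open>The image of a coset is a singleton because f factors through the quotient and
    the coset contains its own representative.\<close>
  have val: "the_elem (f ` C r) = f (of_int r / of_int m)" for r
  proof -
    have "f ` C r = {f (of_int r / of_int m)}"
      using f L memC[of r r] unfolding factors_through_def C_def E_def by fastforce
    then show ?thesis by simp
  qed
  show ?thesis
    unfolding quotient_sum_def E_def[symmetric] q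
    by (simp add: sum.reindex[OF inj] val)
qed

subsection \<open>The false theta function\<close>

lemma matrix_inv_unique:
  fixes A B :: "real^'n^'n"
  assumes "A ** B = mat 1"
  shows "matrix_inv A = B"
proof -
  have BA: "B ** A = mat 1" using assms matrix_left_right_inverse by blast
  then have "invertible A" using assms by (auto simp: invertible_def)
  then have "matrix_inv A ** A = mat 1"
    unfolding matrix_inv_def invertible_def by (rule someI2_ex) simp
  then show ?thesis
    by (metis assms matrix_mul_assoc matrix_mul_lid matrix_mul_rid)
qed

lemma vector2_eq_iff: "(v :: 'a::zero^2) = vector [x, y] \<longleftrightarrow> v $ 1 = x \<and> v $ 2 = y"
  by (auto simp: vec_eq_iff forall_2)

text \<open>Since det S = MN(ac - MNb^2) = MN, the matrix \<open>?B\<close> is the inverse of 2S. In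
  the numerators over 2M and 2N it acts on integer vectors by an integer matrix of determinant ac -
  MNb^2 = 1, hence onto; the preimage in \<open>pre\<close> is given by the inverse of that
  matrix.\<close>

lemma dual_lattice_S_mat:
  fixes M N a b c :: int
  assumes "M > 0" "N > 0" and det: "a * c - M * N * b\<^sup>2 = 1"
  shows "dual_lattice (S_mat M N a b c)
    = range (\<lambda>(p, r). vector [of_int p / of_int (2 * M), of_int r / of_int (2 * N)])"
proof -
  let ?B = "vector [vector [of_int c / of_int (2 * M), - of_int b / 2],
                    vector [- of_int b / 2, of_int a / of_int (2 * N)]] :: real^2^2"
  have det': "of_int a * of_int c - of_int M * of_int N * (of_int b)\<^sup>2 = (1::real)"
    using det by (metis of_int_1 of_int_diff of_int_mult of_int_power)
  have "2 *\<^sub>R S_mat M N a b c ** ?B = mat 1"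
    using assms(1,2) det'
    by (simp add: vec_eq_iff forall_2 matrix_matrix_mult_def sum_2 S_mat_def mat_def vector_2
        field_simps power2_eq_square)
  then have inv: "matrix_inv (2 *\<^sub>R S_mat M N a b c) = ?B" by (rule matrix_inv_unique)
  have mult: "?B *v vector [of_int x, of_int y]
    = vector [of_int (c * x - M * b * y) / of_int (2 * M), of_int (a * y - N * b * x) / of_int (2 * N)]"
    for x y :: int
    using assms(1,2)
    by (simp add: vec_eq_iff forall_2 matrix_vector_mult_def sum_2 vector_2 field_simps)
  have int_vecs: "int_vecs = range (\<lambda>(x, y). vector [of_int x, of_int y])"
  proof (intro equalityI subsetI)
    fix v :: "real^2" assume "v \<in> int_vecs"
    then have "v $ 1 \<in> \<int>" "v $ 2 \<in> \<int>" by (auto simp: int_vecs_def)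
    then obtain x y where "v $ 1 = of_int x" "v $ 2 = of_int y" by (metis Ints_cases)
    then have "v = vector [of_int x, of_int y]" by (simp add: vector2_eq_iff)
    then show "v \<in> range (\<lambda>(x, y). vector [of_int x, of_int y])" by auto
  qed (auto simp: int_vecs_def forall_2 vector_2)
  have "dual_lattice (S_mat M N a b c) = (\<lambda>(x, y). ?B *v vector [of_int x, of_int y]) ` UNIV"
    unfolding dual_lattice_def inv int_vecs by (simp add: image_image case_prod_unfold)
  also have "\<dots> = (\<lambda>(p, r). vector [of_int p / of_int (2 * M), of_int r / of_int (2 * N)])
      ` (range (\<lambda>(x, y). (c * x - M * b * y, a * y - N * b * x)))"
    unfolding image_image by (simp only: mult case_prod_unfold fst_conv snd_conv)
  also have "range (\<lambda>(x, y). (c * x - M * b * y, a * y - N * b * x)) = UNIV"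
  proof -
    let ?f = "\<lambda>(x, y). (c * x - M * b * y, a * y - N * b * x)"
    have pre: "(p, r) = ?f (a * p + M * b * r, N * b * p + c * r)" for p r
    proof -
      have "c * (a * p + M * b * r) - M * b * (N * b * p + c * r) = (a * c - M * N * b\<^sup>2) * p"
        "a * (N * b * p + c * r) - N * b * (a * p + M * b * r) = (a * c - M * N * b\<^sup>2) * r"
        by (simp_all add: algebra_simps power2_eq_square)
      then show ?thesis by (simp add: det)
    qed
    show ?thesis
    proof (rule UNIV_eq_I[symmetric])
      show "z \<in> range ?f" for z
        by (rule range_eqI[where x = "(a * fst z + M * b * snd z, N * b * fst z + c * snd z)"])
          (simp only: pre[symmetric] prod.collapse)
    qed
  qed
  finally show ?thesis .
qed

lemma sum_int_eq_sum_nat: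
  fixes m :: int
  assumes "m \<ge> 0"
  shows "(\<Sum>r\<in>{0..<m}. f r) = (\<Sum>j<nat m. f (int j))"
  using sum.atLeast_int_lessThan_int_shift[of f 0 "nat m"] assms by (simp add: lessThan_atLeast0)

text \<open>The real part of \<tau> contributes the phase, which becomes part of the periodic
  weight, and the imaginary part contributes the Gaussian damping.\<close>

lemma ee_of_real_mult_Complex:
  "ee (of_real q * Complex x t) = ee (of_real (x * q)) * of_real (exp (- (2 * pi * t * q)))"
proof -
  have "2 * of_real pi * \<i> * (of_real q * Complex x t)
      = 2 * of_real pi * \<i> * of_real (x * q) + of_real (- (2 * pi * t * q))"
    by (simp add: complex_eq_iff)
  then show ?thesis unfolding ee_def by (simp only: exp_add exp_of_real)
qed

theorem proposition5p3:
  fixes h k M N a b c :: int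
    and S :: "real^2^2" and L :: "(real^2) set" and Q :: "real^2 \<Rightarrow> real"
    and \<epsilon> :: "real^2 \<Rightarrow> complex"
  assumes "k > 0" and "gcd h k = 1"
    and "M > 0" and "N > 0" and "a > 0" and "c > 0"
    and "a * c - M * N * b\<^sup>2 = 1"
    and S_def: "S = S_mat M N a b c"
    and Q_def: "Q = Q_form M N a b c"
    and L_def: "L = dual_lattice S"
    and periodic: "factors_through L int_vecs \<epsilon>"
    and sum_zero: "quotient_sum L int_vecs \<epsilon> = 0"
    and denoms: "\<forall>\<gamma>\<in>L. \<epsilon> \<gamma> \<noteq> 0 \<longrightarrow>
      lowest_terms_denom (\<gamma> $ 1) (2 * M) \<and> lowest_terms_denom (\<gamma> $ 2) (2 * N)"
    and classes: "\<forall>\<gamma>\<in>L. \<forall>\<gamma>'\<in>L. \<epsilon> \<gamma> \<noteq> 0 \<and> \<epsilon> \<gamma>' \<noteq> 0 \<longrightarrow>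
        of_int M * \<gamma> $ 1 - of_int M * \<gamma>' $ 1 \<in> \<int>
      \<and> of_int N * \<gamma> $ 2 - of_int N * \<gamma>' $ 2 \<in> \<int>
      \<and> of_int M * (\<gamma> $ 1)\<^sup>2 - of_int M * (\<gamma>' $ 1)\<^sup>2 \<in> \<int>
      \<and> of_int N * (\<gamma> $ 2)\<^sup>2 - of_int N * (\<gamma>' $ 2)\<^sup>2 \<in> \<int>
      \<and> of_int (2 * M * N) * \<gamma> $ 1 * \<gamma> $ 2 - of_int (2 * M * N) * \<gamma>' $ 1 * \<gamma>' $ 2 \<in> \<int>"
    and symmetric: "\<forall>\<gamma>\<in>L.
        \<epsilon> \<gamma> = \<epsilon> (vector [1, 1] - \<gamma>)
      \<and> \<epsilon> \<gamma> = \<epsilon> (vector [1 - \<gamma> $ 1, \<gamma> $ 2])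
      \<and> \<epsilon> \<gamma> = \<epsilon> (vector [\<gamma> $ 1, 1 - \<gamma> $ 2])"
    and product: "\<exists>chi psi.
        factors_through (frac_multiples (2 * M)) \<int> chi
      \<and> factors_through (frac_multiples (2 * N)) \<int> psi
      \<and> quotient_sum (frac_multiples (2 * M)) \<int> chi = 0
      \<and> quotient_sum (frac_multiples (2 * N)) \<int> psi = 0
      \<and> (\<forall>\<alpha>\<in>frac_multiples (2 * M). \<forall>\<beta>\<in>frac_multiples (2 * N).
            \<epsilon> (vector [\<alpha>, \<beta>]) = chi \<alpha> * psi \<beta>)"
  shows "((\<lambda>t::real. false_theta S Q \<epsilon> (Complex (of_int h / of_int k) t)) \<longlongrightarrow>
      1 / (of_int k)\<^sup>2 *
      (\<Sum>\<gamma> \<in> {\<gamma> \<in> L. 0 \<le> \<gamma> $ 1 \<and> \<gamma> $ 1 < of_int k \<and> 0 \<le> \<gamma> $ 2 \<and> \<gamma> $ 2 < of_int k}.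
         \<epsilon> \<gamma> * ee (of_real (of_int h / of_int k * Q \<gamma>)) * of_real (\<gamma> $ 1) * of_real (\<gamma> $ 2)))
     (at_right 0)"
proof -
  obtain chi psi where chi: "factors_through (frac_multiples (2 * M)) \<int> chi"
      "quotient_sum (frac_multiples (2 * M)) \<int> chi = 0"
    and psi: "factors_through (frac_multiples (2 * N)) \<int> psi"
      "quotient_sum (frac_multiples (2 * N)) \<int> psi = 0"
    and eps: "\<forall>\<alpha>\<in>frac_multiples (2 * M). \<forall>\<beta>\<in>frac_multiples (2 * N).
            \<epsilon> (vector [\<alpha>, \<beta>]) = chi \<alpha> * psi \<beta>"
    using product by blast
  define g :: "int \<Rightarrow> int \<Rightarrow> real^2"
    where "g p r = vector [of_int p / of_int (2 * M), of_int r / of_int (2 * N)]" for p r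
  define X Y where "X p = chi (of_int p / of_int (2 * M))" and "Y r = psi (of_int r / of_int (2 * N))" for p r :: int
  \<comment> \<open>Q(\<gamma>) in terms of the numerators p = 2M \<alpha> and r = 2N
    \<beta>.\<close>
  define q :: "int \<Rightarrow> int \<Rightarrow> real" where "q p r =
    of_int a * (of_int p)\<^sup>2 / (4 * of_int M) + of_int b * of_int p * of_int r / 2
      + of_int c * (of_int r)\<^sup>2 / (4 * of_int N)" for p r
  define G0 where "G0 p r = X p * Y r * ee (of_real (of_int h / of_int k * q p r))" for p r
  have L: "L = range (\<lambda>(p, r). g p r)"
    unfolding L_def S_def g_def by (rule dual_lattice_S_mat) (use assms in auto)
  have g_nth: "g p r $ 1 = of_int p / of_int (2 * M)" "g p r $ 2 = of_int r / of_int (2 * N)" for p r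
    by (simp_all add: g_def vector_2)
  have gL: "g p r \<in> L" for p r unfolding L by auto
  have eps_g: "\<epsilon> (g p r) = X p * Y r" for p r
    using eps unfolding g_def X_def Y_def frac_multiples_def by blast
  have Q_g: "Q (g p r) = q p r" for p r
    using assms(3,4) unfolding Q_def Q_form_def g_nth q_def by (simp add: field_simps power2_eq_square)
  have frac_per: "f (of_int i / of_int m) = f (of_int j / of_int m)"
    if "factors_through (frac_multiples m) \<int> f" "m > 0" "m dvd i - j"
    for f :: "real \<Rightarrow> complex" and m i j :: int
  proof -
    have "of_int i / of_int m - of_int j / of_int m = (of_int (i - j) / of_int m :: real)"
      by (simp add: diff_divide_distrib)
    also have "\<dots> \<in> \<int>" using that(2,3) by (subst of_int_divide_in_Ints_iff) auto
    finally show ?thesis using that(1) unfolding factors_through_def frac_multiples_def by blast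
  qed
  have X_per: "X i = X j" if "2 * M dvd i - j" for i j
    unfolding X_def using assms(3) that by (intro frac_per chi) auto
  have Y_per: "Y i = Y j" if "2 * N dvd i - j" for i j
    unfolding Y_def using assms(4) that by (intro frac_per psi) auto
  have X_sum: "(\<Sum>p\<in>{0..<2*M}. X p) = 0"
    using quotient_sum_frac_multiples[OF _ chi(1)] chi(2) assms(3) by (simp add: X_def)
  have Y_sum: "(\<Sum>r\<in>{0..<2*N}. Y r) = 0"
    using quotient_sum_frac_multiples[OF _ psi(1)] psi(2) assms(4) by (simp add: Y_def)
  \<comment> \<open>The assumptions concern \<epsilon> = X Y, so they give information about one
    factor only where the other is nonzero. This is the reason for the case distinctions in
    \<open>rows\<close> and \<open>cols\<close>.\<close>
  have cop: "coprime p (2 * M) \<and> coprime r (2 * N)" if "X p \<noteq> 0" "Y r \<noteq> 0" for p r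
  proof -
    have *: "coprime i d" if low: "lowest_terms_denom (of_int i / of_int d) d" for i d :: int
    proof -
      obtain j where j: "coprime j d" "of_int i / of_int d = (of_int j / of_int d :: real)" "d > 0"
        using low unfolding lowest_terms_denom_def by blast
      then have "i = j" by simp
      then show ?thesis using j by simp
    qed
    have "lowest_terms_denom (g p r $ 1) (2 * M) \<and> lowest_terms_denom (g p r $ 2) (2 * N)"
      using denoms gL that by (simp add: eps_g)
    then show ?thesis unfolding g_nth using * by blast
  qed
  \<comment> \<open>M \<alpha>^2 equals p^2/(4M), so its class mod 1 is the class of p^2 mod 4M;
    likewise for N \<beta>^2.\<close>
  have sq: "4 * M dvd p\<^sup>2 - p'\<^sup>2 \<and> 4 * N dvd r\<^sup>2 - r'\<^sup>2"
    if "X p \<noteq> 0" "Y r \<noteq> 0" "X p' \<noteq> 0" "Y r' \<noteq> 0" for p r p' r'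
  proof -
    have *: "4 * d dvd i\<^sup>2 - j\<^sup>2"
      if "d > 0" "of_int d * (of_int i / of_int (2 * d))\<^sup>2 - of_int d * (of_int j / of_int (2 * d))\<^sup>2 \<in> (\<int>::real set)"
      for d i j :: int
    proof -
      have "of_int d * (of_int i / of_int (2 * d))\<^sup>2 - of_int d * (of_int j / of_int (2 * d))\<^sup>2
          = (of_int (i\<^sup>2 - j\<^sup>2) / of_int (4 * d) :: real)"
        using that(1) by (simp add: field_simps power2_eq_square)
      then show ?thesis using that of_int_divide_in_Ints_iff[of "4 * d" "i\<^sup>2 - j\<^sup>2"] by (simp only:)
    qed
    have "of_int M * (g p r $ 1)\<^sup>2 - of_int M * (g p' r' $ 1)\<^sup>2 \<in> \<int>"
      "of_int N * (g p r $ 2)\<^sup>2 - of_int N * (g p' r' $ 2)\<^sup>2 \<in> \<int>"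
      using classes gL that by (simp_all add: eps_g)
    then show ?thesis unfolding g_nth using * assms(3,4) by blast
  qed
  have hk: "coprime h k" using assms(2) by (simp add: coprime_iff_gcd_eq_1)
  \<comment> \<open>A common divisor of c and N, or of a and M, divides ac - MNb^2 = 1.\<close>
  have cN: "coprime c N" and aM: "coprime a M"
  proof -
    have "u dvd 1" if "u dvd c" "u dvd N" for u
    proof -
      have "u dvd a * c - M * N * b\<^sup>2" using that by (intro dvd_diff dvd_mult dvd_mult2) auto
      then show ?thesis using assms(7) by simp
    qed
    then show "coprime c N" by (auto intro: coprimeI)
    have "u dvd 1" if "u dvd a" "u dvd M" for u
    proof -
      have "u dvd a * c - M * N * b\<^sup>2" using that by (intro dvd_diff dvd_mult2) auto
      then show ?thesis using assms(7) by simp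
    qed
    then show "coprime a M" by (auto intro: coprimeI)
  qed
  have rows: "(\<Sum>r\<in>{0..<2*N*k}. G0 p r) = 0" for p
  proof (cases "X p = 0")
    case False
    have "(\<Sum>r\<in>{0..<2*N*k}. Y r * ee (of_real (of_int h / of_int k *
       (of_int b * of_int p * of_int r / 2 + of_int c * (of_int r)\<^sup>2 / (4 * of_int N))))) = 0"
      by (rule twisted_sum_eq_0[OF assms(1,4) hk cN Y_per Y_sum]) (use cop sq False in blast)+
    moreover have "G0 p r = X p * ee (of_real (of_int h / of_int k * (of_int a * (of_int p)\<^sup>2 / (4 * of_int M)))) *
      (Y r * ee (of_real (of_int h / of_int k *
       (of_int b * of_int p * of_int r / 2 + of_int c * (of_int r)\<^sup>2 / (4 * of_int N)))))" for r
    proof -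
      have "of_int h / of_int k * q p r = of_int h / of_int k * (of_int a * (of_int p)\<^sup>2 / (4 * of_int M))
        + of_int h / of_int k * (of_int b * of_int p * of_int r / 2 + of_int c * (of_int r)\<^sup>2 / (4 * of_int N))"
        unfolding q_def by (simp only: distrib_left add.assoc)
      then show ?thesis unfolding G0_def by (simp only: of_real_add ee_add mult_ac)
    qed
    ultimately show ?thesis by (simp flip: sum_distrib_left)
  qed (simp add: G0_def)
  have cols: "(\<Sum>p\<in>{0..<2*M*k}. G0 p r) = 0" for r
  proof (cases "Y r = 0")
    case False
    have "(\<Sum>p\<in>{0..<2*M*k}. X p * ee (of_real (of_int h / of_int k *
       (of_int b * of_int r * of_int p / 2 + of_int a * (of_int p)\<^sup>2 / (4 * of_int M))))) = 0"
      by (rule twisted_sum_eq_0[OF assms(1,3) hk aM X_per X_sum]) (use cop sq False in blast)+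
    moreover have "G0 p r = Y r * ee (of_real (of_int h / of_int k * (of_int c * (of_int r)\<^sup>2 / (4 * of_int N)))) *
      (X p * ee (of_real (of_int h / of_int k *
       (of_int b * of_int r * of_int p / 2 + of_int a * (of_int p)\<^sup>2 / (4 * of_int M)))))" for p
    proof -
      have "of_int h / of_int k * q p r = of_int h / of_int k * (of_int c * (of_int r)\<^sup>2 / (4 * of_int N))
        + of_int h / of_int k * (of_int b * of_int r * of_int p / 2 + of_int a * (of_int p)\<^sup>2 / (4 * of_int M))"
        unfolding q_def by (simp only: distrib_left add_ac mult_ac)
      then show ?thesis unfolding G0_def by (simp only: of_real_add ee_add mult_ac)
    qed
    ultimately show ?thesis by (simp flip: sum_distrib_left)
  qed (simp add: G0_def)
  \<comment> \<open>A step by 2Mk in p or 2Nk in r changes q by a multiple of k, so that (h/k) q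
    changes by an integer.\<close>
  have G0_per: "G0 p r = G0 p' r'" if G0_dvd: "2 * M * k dvd p - p'" "2 * N * k dvd r - r'" for p r p' r'
  proof -
    obtain x y where "p - p' = 2 * M * k * x" "r - r' = 2 * N * k * y" using G0_dvd unfolding dvd_def by blast
    then have p: "p = p' + 2 * M * k * x" "r = r' + 2 * N * k * y" by auto
    have "of_int h / of_int k * q p r - of_int h / of_int k * q p' r'
      = of_int (h * (a * x * (p' + M * k * x) + b * (M * x * r' + N * y * p' + 2 * M * N * k * x * y)
          + c * y * (r' + N * k * y)))"
      unfolding q_def p using assms(1,3,4) by (simp add: field_simps power2_eq_square)
    then have "ee (of_real (of_int h / of_int k * q p r)) = ee (of_real (of_int h / of_int k * q p' r'))"
      by (intro ee_of_real_cong) (simp only: Ints_of_int)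
    moreover have "X p = X p'" "Y r = Y r'" by (auto intro!: X_per Y_per simp: p)
    ultimately show ?thesis by (simp add: G0_def)
  qed
  define P R where "P = nat (2 * M * k)" and "R = nat (2 * N * k)"
  have PR: "int P = 2 * M * k" "int R = 2 * N * k" "P > 0" "R > 0"
    using assms(1,3,4) by (auto simp: P_def R_def)
  define G where "G i j = G0 (int i) (int j)" for i j
  \<comment> \<open>Chosen so that A p^2 + 2B p r + C r^2 = 2 pi q(p, r); the damping factor at
    height t is then the Gaussian at scale s = sqrt t.\<close>
  define A B C where "A = pi * of_int a / (2 * of_int M)" and "B = pi * of_int b / 2"
    and "C = pi * of_int c / (2 * of_int N)"
  have A: "A > 0" using assms by (simp add: A_def)
  \<comment> \<open>Positive definiteness is the determinant condition again: AC - B^2 = pi^2 (ac -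
    MNb^2)/(4MN).\<close>
  have "of_int M * of_int N * (of_int b)\<^sup>2 < (of_int a * of_int c :: real)"
  proof -
    have "M * N * b\<^sup>2 < a * c" using assms(7) by linarith
    then have "of_int (M * N * b\<^sup>2) < (of_int (a * c) :: real)" by (simp only: of_int_less_iff)
    then show ?thesis by simp
  qed
  then have "pi\<^sup>2 * (of_int M * of_int N * (of_int b)\<^sup>2) < pi\<^sup>2 * (of_int a * of_int c)"
    by (intro mult_strict_left_mono) auto
  then have AC: "B\<^sup>2 < A * C"
    using assms(3,4) by (simp add: A_def B_def C_def field_simps power2_eq_square)
  have lim: "((\<lambda>s. \<Sum>\<^sub>\<infinity>(i,j). G i j * of_real (gauss A B C (s * real i) (s * real j))) \<longlongrightarrow>
    (\<Sum>p<P. \<Sum>r<R. G p r * of_real (real p * real r / (real P * real R)))) (at_right 0)"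
  proof (rule periodic_gauss_sum_limit[OF A AC PR(3,4)])
    show "G i j = G (i mod P) (j mod R)" for i j
      unfolding G_def by (rule G0_per) (simp_all add: zmod_int dvd_minus_mod flip: PR(1,2))
    show "(\<Sum>j<R. G i j) = 0" for i
      using rows[of "int i"] assms(1,4) by (subst (asm) sum_int_eq_sum_nat) (auto simp: G_def R_def)
    show "(\<Sum>i<P. G i j) = 0" for j
      using cols[of "int j"] assms(1,3) by (subst (asm) sum_int_eq_sum_nat) (auto simp: G_def P_def)
  qed
  have g_inj: "g p r = g p' r' \<longleftrightarrow> p = p' \<and> r = r'" for p r p' r'
    using assms(3,4) by (auto simp: g_def vector2_eq_iff vector_2)
  have theta: "false_theta S Q \<epsilon> (Complex (of_int h / of_int k) t)
    = (\<Sum>\<^sub>\<infinity>(i,j). G i j * of_real (gauss A B C (sqrt t * real i) (sqrt t * real j)))"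
    if "t > 0" for t
  proof -
    have bij: "bij_betw (\<lambda>(i,j). g (int i) (int j)) UNIV {\<gamma> \<in> L. 0 \<le> \<gamma> $ 1 \<and> 0 \<le> \<gamma> $ 2}"
    proof (rule bij_betw_imageI)
      show "inj (\<lambda>(i,j). g (int i) (int j))" by (auto simp: inj_on_def g_inj)
      show "(\<lambda>(i,j). g (int i) (int j)) ` UNIV = {\<gamma> \<in> L. 0 \<le> \<gamma> $ 1 \<and> 0 \<le> \<gamma> $ 2}"
      proof (intro equalityI subsetI)
        fix \<gamma> assume "\<gamma> \<in> {\<gamma> \<in> L. 0 \<le> \<gamma> $ 1 \<and> 0 \<le> \<gamma> $ 2}"
        then obtain p r where pr: "\<gamma> = g p r" "0 \<le> \<gamma> $ 1" "0 \<le> \<gamma> $ 2" by (auto simp: L)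
        then have "0 \<le> p" "0 \<le> r" using assms(3,4) by (auto simp: g_nth zero_le_divide_iff)
        then have "\<gamma> = (\<lambda>(i,j). g (int i) (int j)) (nat p, nat r)" using pr by simp
        then show "\<gamma> \<in> (\<lambda>(i,j). g (int i) (int j)) ` UNIV" by blast
      qed (use gL assms(3,4) in \<open>auto simp: g_nth\<close>)
    qed
    have "false_theta S Q \<epsilon> (Complex (of_int h / of_int k) t)
      = (\<Sum>\<^sub>\<infinity>x. \<epsilon> ((\<lambda>(i,j). g (int i) (int j)) x) *
           ee (of_real (Q ((\<lambda>(i,j). g (int i) (int j)) x)) * Complex (of_int h / of_int k) t))"
      unfolding false_theta_def L_def[symmetric] by (rule infsum_reindex_bij_betw[OF bij, symmetric])
    also have "\<dots> = (\<Sum>\<^sub>\<infinity>(i,j). G i j * of_real (gauss A B C (sqrt t * real i) (sqrt t * real j)))"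
    proof (rule infsum_cong)
      fix x :: "nat \<times> nat"
      obtain i j where x: "x = (i, j)" by fastforce
      have "A * (sqrt t * real i)\<^sup>2 + 2 * B * (sqrt t * real i) * (sqrt t * real j) + C * (sqrt t * real j)\<^sup>2
        = (sqrt t)\<^sup>2 * (A * (real i)\<^sup>2 + 2 * B * real i * real j + C * (real j)\<^sup>2)"
        by (simp add: algebra_simps power2_eq_square)
      also have "\<dots> = 2 * pi * t * q (int i) (int j)"
        using that assms(3,4) by (simp add: A_def B_def C_def q_def field_simps)
      finally have "gauss A B C (sqrt t * real i) (sqrt t * real j) = exp (- (2 * pi * t * q (int i) (int j)))"
        by (simp only: gauss_def)
      then show "\<epsilon> ((\<lambda>(i,j). g (int i) (int j)) x) *
           ee (of_real (Q ((\<lambda>(i,j). g (int i) (int j)) x)) * Complex (of_int h / of_int k) t)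
        = (case x of (i,j) \<Rightarrow> G i j * of_real (gauss A B C (sqrt t * real i) (sqrt t * real j)))"
        by (simp only: x prod.case eps_g Q_g ee_of_real_mult_Complex G_def G0_def mult.assoc)
    qed
    finally show ?thesis .
  qed
  \<comment> \<open>The square [0,k)^2 is exactly one period cell in the numerators, and \<alpha>
    \<beta>/k^2 = pr/(4MNk^2) = pr/(PR).\<close>
  have value_eq: "1 / (of_int k)\<^sup>2 *
      (\<Sum>\<gamma> \<in> {\<gamma> \<in> L. 0 \<le> \<gamma> $ 1 \<and> \<gamma> $ 1 < of_int k \<and> 0 \<le> \<gamma> $ 2 \<and> \<gamma> $ 2 < of_int k}.
         \<epsilon> \<gamma> * ee (of_real (of_int h / of_int k * Q \<gamma>)) * of_real (\<gamma> $ 1) * of_real (\<gamma> $ 2))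
    = (\<Sum>p<P. \<Sum>r<R. G p r * of_real (real p * real r / (real P * real R)))"
  proof -
    let ?D = "{\<gamma> \<in> L. 0 \<le> \<gamma> $ 1 \<and> \<gamma> $ 1 < of_int k \<and> 0 \<le> \<gamma> $ 2 \<and> \<gamma> $ 2 < of_int k}"
    have bij: "bij_betw (\<lambda>(i,j). g (int i) (int j)) ({..<P} \<times> {..<R}) ?D"
    proof (rule bij_betw_imageI)
      show "inj_on (\<lambda>(i,j). g (int i) (int j)) ({..<P} \<times> {..<R})" by (auto simp: inj_on_def g_inj)
      have lt: "of_int p / of_int (2 * m) < (of_int k :: real) \<longleftrightarrow> p < 2 * m * k" if "m > 0" for p m :: int
      proof -
        have "of_int p / of_int (2 * m) < (of_int k :: real) \<longleftrightarrow> of_int p < (of_int (2 * m * k) :: real)"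
          using that by (simp add: field_simps)
        then show ?thesis by (simp only: of_int_less_iff)
      qed
      have D: "g p r \<in> ?D \<longleftrightarrow> 0 \<le> p \<and> p < int P \<and> 0 \<le> r \<and> r < int R" for p r
        using gL assms(3,4) lt[OF assms(3), of p] lt[OF assms(4), of r]
        unfolding PR by (simp add: g_nth zero_le_divide_iff)
      show "(\<lambda>(i,j). g (int i) (int j)) ` ({..<P} \<times> {..<R}) = ?D"
      proof (intro equalityI subsetI)
        fix \<gamma> assume \<gamma>: "\<gamma> \<in> ?D"
        then obtain p r where pr: "\<gamma> = g p r" by (auto simp: L)
        then have "0 \<le> p \<and> p < int P \<and> 0 \<le> r \<and> r < int R" using \<gamma> D by blast
        then have "\<gamma> = (\<lambda>(i,j). g (int i) (int j)) (nat p, nat r)" "(nat p, nat r) \<in> {..<P} \<times> {..<R}"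
          using pr by auto
        then show "\<gamma> \<in> (\<lambda>(i,j). g (int i) (int j)) ` ({..<P} \<times> {..<R})" by (rule image_eqI)
      next
        fix \<gamma> assume "\<gamma> \<in> (\<lambda>(i,j). g (int i) (int j)) ` ({..<P} \<times> {..<R})"
        then obtain i j where "\<gamma> = g (int i) (int j)" "i < P" "j < R" by auto
        then show "\<gamma> \<in> ?D" using D by simp
      qed
    qed
    have PRk: "real P = 2 * of_int M * of_int k" "real R = 2 * of_int N * of_int k"
      using PR(1,2) by (metis of_int_mult of_int_numeral of_int_of_nat_eq)+
    have "1 / (of_int k)\<^sup>2 * (\<Sum>\<gamma> \<in> ?D.
         \<epsilon> \<gamma> * ee (of_real (of_int h / of_int k * Q \<gamma>)) * of_real (\<gamma> $ 1) * of_real (\<gamma> $ 2))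
      = 1 / (of_int k)\<^sup>2 * (\<Sum>(i,j)\<in>{..<P} \<times> {..<R}. G i j * of_real (g (int i) (int j) $ 1) * of_real (g (int i) (int j) $ 2))"
      unfolding sum.reindex_bij_betw[OF bij, symmetric]
      by (simp add: case_prod_unfold eps_g Q_g G_def G0_def)
    also have "\<dots> = (\<Sum>(i,j)\<in>{..<P} \<times> {..<R}. G i j * of_real (real i * real j / (real P * real R)))"
    proof -
      have "1 / (of_int k)\<^sup>2 * (G i j * of_real (g (int i) (int j) $ 1) * of_real (g (int i) (int j) $ 2))
        = G i j * of_real (real i * real j / (real P * real R))" for i j
        using assms(1,3,4) by (simp add: g_nth PRk field_simps power2_eq_square)
      then show ?thesis by (simp only: sum_distrib_left case_prod_unfold)
    qed
    also have "\<dots> = (\<Sum>p<P. \<Sum>r<R. G p r * of_real (real p * real r / (real P * real R)))"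
      by (rule sum.cartesian_product[symmetric])
    finally show ?thesis .
  qed
  \<comment> \<open>The limit is known in s; composing with s = sqrt t transfers it to t tending to
    0 from the right.\<close>
  have "filterlim sqrt (at_right 0) (at_right 0)"
    by (rule filterlim_at_withinI) (auto intro!: tendsto_eq_intros eventually_mono[OF eventually_at_right_less])
  from filterlim_compose[OF lim this] show ?thesis
    unfolding value_eq
    by (rule Lim_transform_eventually)
       (auto intro!: eventually_mono[OF eventually_at_right_less[of 0]] simp: theta)
qed

end
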